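(* Let $\alpha$ be a $\|\cdot\|_{1}$-dominating normalized gauge norm on $L^{\infty}(\mathbb{T},\mu)$. Let $M$ be a $\sigma(L^{\alpha}(\mathbb{T},\mu),L^{\alpha'}(\mathbb{T},\mu))$-closed linear subspace of $L^{\alpha}(\mathbb{T},\mu)$ with $zM\subseteq M$. Then (1) $M\cap L^{\infty}(\mathbb{T},\mu)$ is weak*-closed in $L^{\infty}(\mathbb{T},\mu)$; (2) $M=\overline{M\cap L^{\infty}(\mathbb{T},\mu)}^{\sigma(L^{\alpha}(\mathbb{T},\mu),L^{\alpha'}(\mathbb{T},\mu))}$.
   Context: $\mathbb{T}$ is the unit circle and $\mu$ is normalized arc length; $z$ denotes the identity function on $\mathbb{T}$. A norm $\alpha$ on $L^{\infty}(\mathbb{T},\mu)$ is a normalized gauge norm if $\alpha(1)=1$ and $\alpha(|f|)=\alpha(f)$ for all $f$; it is $\|\cdot\|_1$-dominating if there is $c>0$ with $\alpha(f)\ge c\|f\|_{1}$ for all $f\in L^{\infty}(\mathbb{T},\mu)$. Such $\alpha$ is extended to all measurable $f$ by $\alpha(f)=\sup\{\alpha(s): s \text{ simple},\ 0\le s\le |f|\}\in[0,\infty]$. Put $\mathcal{L}^{\alpha}(\mathbb{T},\mu)=\{f \text{ measurable}:\alpha(f)<\infty\}\subset L^1(\mathbb{T},\mu)$, and let $L^{\alpha}(\mathbb{T},\mu)$ be the $\alpha$-closure of $L^{\infty}(\mathbb{T},\mu)$ in $\mathcal{L}^{\alpha}(\mathbb{T},\mu)$. The dual norm is $\alpha'(f)=\sup\{|\int_{\mathbb{T}}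 fh\,d\mu| : h\in L^{\infty}(\mathbb{T},\mu),\ \alpha(h)\le 1\}$ for $f\in L^{\infty}(\mathbb{T},\mu)$, extended to measurable functions in the same way; $\mathcal{L}^{\alpha'}(\mathbb{T},\mu)=\{f \text{ measurable}:\alpha'(f)<\infty\}$, and $L^{\alpha'}(\mathbb{T},\mu)$ is the $\alpha'$-closure of $L^{\infty}(\mathbb{T},\mu)$ in $\mathcal{L}^{\alpha'}(\mathbb{T},\mu)$. $\sigma(L^{\alpha},L^{\alpha'})$ is the weakest topology on $L^{\alpha}(\mathbb{T},\mu)$ making all functionals $f\mapsto\int_{\mathbb{T}} fg\,d\mu$, $g\in L^{\alpha'}(\mathbb{T},\mu)$, continuous. The weak* topology on $L^\infty(\mathbb{T},\mu)$ is that of the dual of $L^1(\mathbb{T},\mu)$. *)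

theory Defs
  imports "HOL-Analysis.Analysis"
begin

text \<open>
  The spaces below consist of functions rather than of almost-everywhere classes of functions.
  Equality almost everywhere enters through the null space of a norm (see \<open>Linf_norm\<close>) and
  through the pairing topologies: functions that agree almost everywhere on the circle are
  topologically indistinguishable there, so a closed set of functions is automatically a union of
  classes, and closed sets and closures correspond to those in the quotient.  Values of functions
  off the unit circle are irrelevant in the same way.
\<close>

definition circle_measure :: "complex measure" where
  "circle_measure =
     distr (uniform_measure lborel {0..2 * pi}) (restrict_space borel (sphere 0 1)) cis"

definition Linf :: "(complex \<Rightarrow> complex) set" where
  "Linf = {f \<in> borel_measurable circle_measure. \<exists>C. AE x in circle_measure. cmod (f x) \<le> C}"

definition L1 :: "(complex \<Rightarrow> complex) set" where
  "L1 = {f. integrable circle_measure f}"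

definition Linf_norm :: "((complex \<Rightarrow> complex) \<Rightarrow> real) \<Rightarrow> bool" where
  "Linf_norm \<alpha> \<longleftrightarrow>
     (\<forall>f\<in>Linf. 0 \<le> \<alpha> f) \<and>
     (\<forall>f\<in>Linf. \<alpha> f = 0 \<longleftrightarrow> (AE x in circle_measure. f x = 0)) \<and>
     (\<forall>c. \<forall>f\<in>Linf. \<alpha> (\<lambda>x. c * f x) = cmod c * \<alpha> f) \<and>
     (\<forall>f\<in>Linf. \<forall>g\<in>Linf. \<alpha> (\<lambda>x. f x + g x) \<le> \<alpha> f + \<alpha> g)"

definition normalized_gauge_norm :: "((complex \<Rightarrow> complex) \<Rightarrow> real) \<Rightarrow> bool" where
  "normalized_gauge_norm \<alpha> \<longleftrightarrow>
     Linf_norm \<alpha> \<and> \<alpha> (\<lambda>_. 1) = 1 \<and>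
     (\<forall>f\<in>Linf. \<alpha> (\<lambda>x. complex_of_real (cmod (f x))) = \<alpha> f)"

definition L1_dominating :: "((complex \<Rightarrow> complex) \<Rightarrow> real) \<Rightarrow> bool" where
  "L1_dominating \<alpha> \<longleftrightarrow>
     (\<exists>c>0. \<forall>f\<in>Linf. c * (\<integral>x. cmod (f x) \<partial>circle_measure) \<le> \<alpha> f)"

definition ext_norm :: "((complex \<Rightarrow> complex) \<Rightarrow> real) \<Rightarrow> (complex \<Rightarrow> complex) \<Rightarrow> ennreal" where
  "ext_norm \<alpha> f =
     (SUP s \<in> {s :: complex \<Rightarrow> real. simple_function circle_measure s \<and>
                 (AE x in circle_measure. 0 \<le> s x \<and> s x \<le> cmod (f x))}.
        ennreal (\<alpha> (\<lambda>x. complex_of_real (s x))))"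

text \<open>For a dominating \<open>\<alpha>\<close> and \<open>f \<in> Linf\<close> the supremum below is over a bounded nonempty set.\<close>

definition dual_norm :: "((complex \<Rightarrow> complex) \<Rightarrow> real) \<Rightarrow> (complex \<Rightarrow> complex) \<Rightarrow> real" where
  "dual_norm \<alpha> f = (SUP h \<in> {h \<in> Linf. \<alpha> h \<le> 1}. cmod (\<integral>x. f x * h x \<partial>circle_measure))"

definition script_L :: "((complex \<Rightarrow> complex) \<Rightarrow> real) \<Rightarrow> (complex \<Rightarrow> complex) set" where
  "script_L \<alpha> = {f \<in> borel_measurable circle_measure. ext_norm \<alpha> f < \<infinity>}"

definition L_closure :: "((complex \<Rightarrow> complex) \<Rightarrow> real) \<Rightarrow> (complex \<Rightarrow> complex) set" where
  "L_closure \<alpha> =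
     {f \<in> script_L \<alpha>. \<forall>\<epsilon>>0. \<exists>g\<in>Linf. ext_norm \<alpha> (\<lambda>x. f x - g x) < ennreal \<epsilon>}"

text \<open>
  The weakest topology on \<open>X\<close> for which \<open>f \<mapsto> \<integral> f g\<close> is continuous for every \<open>g \<in> Y\<close>.
\<close>

definition pairing_topology ::
    "(complex \<Rightarrow> complex) set \<Rightarrow> (complex \<Rightarrow> complex) set \<Rightarrow> (complex \<Rightarrow> complex) topology" where
  "pairing_topology X Y =
     topology_generated_by
       {{f \<in> X. (\<integral>x. f x * g x \<partial>circle_measure) \<in> U} | g U. g \<in> Y \<and> open U}"

definition sigma_topology ::
    "((complex \<Rightarrow> complex) \<Rightarrow> real) \<Rightarrow> (complex \<Rightarrow> complex) topology" where
  "sigma_topology \<alpha> = pairing_topology (L_closure \<alpha>) (L_closure (dual_norm \<alpha>))"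

definition weak_star_topology :: "(complex \<Rightarrow> complex) topology" where
  "weak_star_topology = pairing_topology Linf L1"

definition linear_subspace :: "(complex \<Rightarrow> complex) set \<Rightarrow> bool" where
  "linear_subspace M \<longleftrightarrow>
     (\<lambda>_. 0) \<in> M \<and>
     (\<forall>f\<in>M. \<forall>g\<in>M. (\<lambda>x. f x + g x) \<in> M) \<and>
     (\<forall>c. \<forall>f\<in>M. (\<lambda>x. c * f x) \<in> M)"

end

theory Submission
  imports Defs
begin

text \<open>
  Since \<open>L\<^sup>\<infinity> \<subseteq> L\<^sup>\<alpha>\<close> and \<open>L\<^sup>\<alpha>\<^sup>' \<subseteq> L\<^sup>1\<close>, the weak* topology is finer than the trace of \<open>\<sigma>(L\<^sup>\<alpha>, L\<^sup>\<alpha>\<^sup>')\<close>,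
  which gives (1).  For (2) let \<open>f \<in> M\<close> and let \<open>F\<close> be \<open>\<bar>f\<bar>\<^sup>1\<^sup>/\<^sup>2\<close> plus \<open>\<i>\<close> times its harmonic conjugate.  Then
  \<open>k\<^sub>n = exp (- F / n)\<close> satisfies \<open>\<bar>k\<^sub>n\<bar> \<le> 1\<close> and \<open>k\<^sub>n \<rightarrow> 1\<close> almost everywhere, and \<open>k\<^sub>n f\<close> is bounded.  As \<open>k\<^sub>n\<close>
  is a bounded pointwise limit of polynomials, dominated convergence puts \<open>k\<^sub>n f\<close> into \<open>M\<close>, and once
  more shows that \<open>k\<^sub>n f \<rightarrow> f\<close>; the dominating functions \<open>f g\<close> with \<open>g \<in> L\<^sup>\<alpha>\<^sup>'\<close> are integrable by Hoelder's
  inequality.  To obtain \<open>F\<close>, approximate \<open>\<bar>f\<bar>\<^sup>1\<^sup>/\<^sup>2\<close> in \<open>L\<^sup>2\<close> by real parts of polynomials \<open>p\<close> with \<open>p(0)\<close> real: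
  the mean value property for \<open>p\<^sup>2\<close> shows that the imaginary parts converge in \<open>L\<^sup>2\<close> as well.
\<close>

section \<open>Normalized arc length\<close>

lemma space_circle_measure [simp]: "space circle_measure = sphere 0 1"
  by (simp add: circle_measure_def space_restrict_space)

lemma sets_circle_measure [measurable_cong]:
  "sets circle_measure = sets (restrict_space borel (sphere 0 1))"
  by (simp add: circle_measure_def)

lemma measurable_cis [measurable]:
  "cis \<in> uniform_measure lborel {0..2 * pi} \<rightarrow>\<^sub>M restrict_space borel (sphere 0 1)"
proof (rule measurable_restrict_space2)
  show "cis \<in> borel_measurable (uniform_measure lborel {0..2 * pi})"
    by (simp add: uniform_measure_def borel_measurable_continuous_onI continuous_on_cis)
qed auto

lemma emeasure_circle_measure: "emeasure circle_measure (sphere 0 1) = 1"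
proof -
  have "cis -` sphere 0 1 = UNIV" by auto
  then have "emeasure circle_measure (sphere 0 1) =
      emeasure (uniform_measure lborel {0..2 * pi}) (space (uniform_measure lborel {0..2 * pi}))"
    unfolding circle_measure_def
    by (subst emeasure_distr) (auto simp: sets_restrict_space)
  also have "\<dots> = 1"
    by (simp add: ennreal_divide_self)
  finally show ?thesis .
qed

lemma finite_measure_circle_measure: "finite_measure circle_measure"
  by (rule finite_measureI) (simp add: emeasure_circle_measure)

interpretation circle: finite_measure circle_measure
  by (rule finite_measure_circle_measure)

lemma measure_circle_measure [simp]: "measure circle_measure (sphere 0 1) = 1"
  by (simp add: measure_def emeasure_circle_measure)

lemma continuous_on_circle_measurable:
  fixes f :: "complex \<Rightarrow> 'a::topological_space"
  assumes "continuous_on (sphere 0 1) f"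
  shows "f \<in> borel_measurable circle_measure"
  using borel_measurable_continuous_on_restrict[OF assms]
  by (simp cong: measurable_cong_sets add: sets_circle_measure)

lemma ident_measurable_circle [measurable]: "(\<lambda>z. z) \<in> borel_measurable circle_measure"
  by (rule continuous_on_circle_measurable) (rule continuous_on_id)

lemma poly_measurable_circle [measurable]:
  fixes p :: "complex poly"
  shows "(\<lambda>z. poly p z) \<in> borel_measurable circle_measure"
  by (rule continuous_on_circle_measurable) (intro continuous_intros)

lemma integrable_circle_bounded:
  fixes f :: "complex \<Rightarrow> 'a::{banach, second_countable_topology}"
  assumes "f \<in> borel_measurable circle_measure" "AE z in circle_measure. norm (f z) \<le> B"
  shows "integrable circle_measure f"
  by (rule circle.integrable_const_bound[of _ B]) (use assms in auto)

lemma integrable_circle_continuous: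
  fixes f :: "complex \<Rightarrow> 'a::{banach, second_countable_topology}"
  assumes "continuous_on (sphere 0 1) f"
  shows "integrable circle_measure f"
proof -
  have "compact (f ` sphere 0 1)"
    by (intro compact_continuous_image assms compact_sphere)
  then obtain B where "\<And>z. z \<in> sphere 0 1 \<Longrightarrow> norm (f z) \<le> B"
    using compact_imp_bounded bounded_iff by (metis image_eqI)
  then show ?thesis
    by (intro integrable_circle_bounded[where B = B] continuous_on_circle_measurable assms) 
       (auto intro!: AE_I2)
qed

text \<open>Pulled back along \<open>cis\<close>, the integrand becomes exp (i (k + 1) t). Its
  antiderivative is 2 pi-periodic because k + 1 is a nonzero integer.\<close>

lemma integral_circle_power_Suc: "(\<integral>z. z ^ Suc k \<partial>circle_measure) = 0"
proof -
  let ?F = "\<lambda>t. cis (real (Suc k) * t) / (\<i> * of_nat (Suc k))"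
  have "(\<integral>z. z ^ Suc k \<partial>circle_measure) =
      (\<integral>t. cis t ^ Suc k \<partial>uniform_measure lborel {0..2 * pi})"
    unfolding circle_measure_def
    by (rule integral_distr) (auto intro!: measurable_restrict_space1)
  also have "\<dots> = (\<integral>t. (indicator {0..2 * pi} t / (2 * pi)) *\<^sub>R cis (real (Suc k) * t) \<partial>lborel)"
  proof -
    have "uniform_measure lborel {0..2 * pi} =
        density lborel (\<lambda>t. ennreal (indicator {0..2 * pi} t / (2 * pi)))"
      unfolding uniform_measure_def
      by (intro density_cong)
         (auto simp: ennreal_indicator[symmetric] divide_ennreal intro!: AE_I2)
    then show ?thesis
      by (simp add: integral_density Complex.DeMoivre borel_measurable_continuous_onI
            continuous_on_cis del: power_Suc)
  qed
  also have "\<dots> = (1 / (2 * pi)) *\<^sub>R (\<integral>t. indicator {0..2 * pi} t *\<^sub>R cis (real (Suc k) * t) \<partial>lborel)"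
    by (subst integral_scaleR_right[symmetric]) (simp add: field_simps)
  also have "(\<integral>t. indicator {0..2 * pi} t *\<^sub>R cis (real (Suc k) * t) \<partial>lborel) = ?F (2 * pi) - ?F 0"
  proof (rule integral_FTC_Icc)
    show "(?F has_vector_derivative cis (real (Suc k) * t)) (at t within {0..2 * pi})"
      for t
    proof -
      define a where "a = \<i> * complex_of_nat (Suc k)"
      have a: "a \<noteq> 0" unfolding a_def by (simp del: of_nat_Suc)
      have cis: "cis (real (Suc k) * t) = exp (a * of_real t)" for t
        by (simp add: cis_conv_exp a_def algebra_simps)
      have "((\<lambda>x. exp (a * of_real x) / a) has_vector_derivative exp (a * of_real t)) (at t within {0..2 * pi})"
        by (rule has_vector_derivative_real_field[where f = "\<lambda>w. exp (a * w) / a"])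
           (use a in \<open>auto intro!: derivative_eq_intros\<close>)
      then show ?thesis
        unfolding cis unfolding a_def .
    qed
    show "continuous_on {0..2 * pi} (\<lambda>t. cis (real (Suc k) * t))"
      by (intro continuous_intros)
  qed auto
  also have "?F (2 * pi) = ?F 0"
    using cis_multiple_2pi[of "real (Suc k)"] by (simp add: mult.commute mult.left_commute)
  finally show ?thesis by simp
qed

lemma integral_circle_poly:
  fixes p :: "complex poly"
  shows "(\<integral>z. poly p z \<partial>circle_measure) = poly p 0"
proof -
  \<comment> \<open>The extra factor leaves only positive powers of z, so no constant term survives.
    Keeping k arbitrary absorbs the power of z that each \<open>pCons\<close> produces.\<close>
  have *: "(\<integral>z. z ^ Suc k * poly p z \<partial>circle_measure) = 0" for k and p :: "complex poly"
  proof (induction p arbitrary: k)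
    case (pCons a p)
    have "(\<integral>z. z ^ Suc k * poly (pCons a p) z \<partial>circle_measure) =
        (\<integral>z. a * z ^ Suc k + z ^ Suc (Suc k) * poly p z \<partial>circle_measure)"
      by (simp add: algebra_simps)
    also have "\<dots> = (\<integral>z. a * z ^ Suc k \<partial>circle_measure)
        + (\<integral>z. z ^ Suc (Suc k) * poly p z \<partial>circle_measure)"
      by (intro Bochner_Integration.integral_add integrable_circle_continuous continuous_intros)
    also have "\<dots> = 0"
      using pCons.IH[of "Suc k"] by (simp add: integral_circle_power_Suc del: power_Suc)
    finally show ?case .
  qed simp
  obtain a q where p: "p = pCons a q" by (cases p)
  have "(\<integral>z. poly p z \<partial>circle_measure) = (\<integral>z. a + z ^ Suc 0 * poly q z \<partial>circle_measure)"
    by (simp add: p)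
  also have "\<dots> = (\<integral>z. a \<partial>circle_measure) + (\<integral>z. z ^ Suc 0 * poly q z \<partial>circle_measure)"
    by (intro Bochner_Integration.integral_add integrable_circle_continuous continuous_intros)
  finally show ?thesis
    using *[of 0 q] by (simp add: p)
qed

text \<open>The real part of the integral of \<open>p\<^sup>2\<close> gives the \<open>L\<^sup>2\<close> bound for the conjugate function.\<close>

lemma integral_Im_poly_le:
  fixes p :: "complex poly"
  assumes "Im (poly p 0) = 0"
  shows "(\<integral>z. (Im (poly p z))\<^sup>2 \<partial>circle_measure) \<le> (\<integral>z. (Re (poly p z))\<^sup>2 \<partial>circle_measure)"
proof -
  have "(\<integral>z. (Re (poly p z))\<^sup>2 \<partial>circle_measure) - (\<integral>z. (Im (poly p z))\<^sup>2 \<partial>circle_measure) =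
      (\<integral>z. (Re (poly p z))\<^sup>2 - (Im (poly p z))\<^sup>2 \<partial>circle_measure)"
    by (intro Bochner_Integration.integral_diff[symmetric] integrable_circle_continuous continuous_intros)
  also have "\<dots> = (\<integral>z. Re (poly (p\<^sup>2) z) \<partial>circle_measure)"
    by (simp add: power2_eq_square)
  also have "\<dots> = Re (\<integral>z. poly (p\<^sup>2) z \<partial>circle_measure)"
    by (intro integral_Re integrable_circle_continuous continuous_intros)
  \<comment> \<open>By the mean value property the integral of p^2 is p(0)^2, and p(0) is real; so
    the difference of the two integrals is a square.\<close>
  also have "\<dots> = (Re (poly p 0))\<^sup>2"
    using assms unfolding integral_circle_poly by (simp add: power2_eq_square)
  finally show ?thesis
    using zero_le_power2[of "Re (poly p 0)"] by linarith
qed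

section \<open>Density of real parts of polynomials\<close>

text \<open>On the circle these are the real trigonometric polynomials. Only values on the circle
  are compared, because closure under products rests on cnj z = 1/z there.\<close>

definition re_poly :: "(complex \<Rightarrow> real) \<Rightarrow> bool" where
  "re_poly g \<longleftrightarrow> (\<exists>p::complex poly. \<forall>z\<in>sphere 0 1. g z = Re (poly p z))"

lemma re_poly_add: "re_poly f \<Longrightarrow> re_poly g \<Longrightarrow> re_poly (\<lambda>z. f z + g z)"
  unfolding re_poly_def by (metis plus_complex.sel(1) poly_add)

lemma re_poly_sum: "(\<And>i. i \<in> A \<Longrightarrow> re_poly (f i)) \<Longrightarrow> re_poly (\<lambda>z. \<Sum>i\<in>A. f i z)"
proof (induction A rule: infinite_finite_induct)
  case (insert x F)
  then show ?case using re_poly_add[of "f x"] by simp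
qed (auto simp: re_poly_def intro!: exI[of _ 0])

text \<open>Re u Re v is the real part of (u v + u cnj v) / 2, and on the circle z^i cnj (z^j) =
  z^(i-j) for j at most i. The other case follows by exchanging the factors.\<close>

lemma re_poly_monom_mult: "re_poly (\<lambda>z. Re (a * z ^ i) * Re (b * z ^ j))"
proof -
  have *: "re_poly (\<lambda>z. Re (a * z ^ i) * Re (b * z ^ j))" if "j \<le> i" for a b and i j :: nat
    unfolding re_poly_def
  proof (intro exI ballI)
    fix z :: complex assume z: "z \<in> sphere 0 1"
    then have "cnj z ^ j * z ^ j = 1"
      by (metis complex_norm_square dist_0_norm mem_sphere mult.commute of_real_1 power_mult_distrib power_one)
    then have "cnj z ^ j * z ^ i = z ^ (i - j)"
      by (metis (no_types, lifting) le_add_diff_inverse mult.assoc mult_1 power_add that)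
    then have 1: "a * cnj b * z ^ (i - j) = (a * z ^ i) * cnj (b * z ^ j)"
      by (simp add: algebra_simps)
    have 2: "a * b * z ^ (i + j) = (a * z ^ i) * (b * z ^ j)"
      by (simp add: power_add)
    have 3: "Re u * Re v = Re ((u * v + u * cnj v) / 2)" for u v
      by (simp add: field_simps)
    show "Re (a * z ^ i) * Re (b * z ^ j) =
        Re (poly (monom (a * b / 2) (i + j) + monom (a * cnj b / 2) (i - j)) z)"
      using 3[of "a * z ^ i" "b * z ^ j"] unfolding 1[symmetric] 2[symmetric]
      by (simp add: poly_monom add_divide_distrib)
  qed
  show ?thesis
    using *[of j i a b] *[of i j b a] by (cases "j \<le> i") (auto simp: mult.commute)
qed

lemma re_poly_mult:
  assumes "re_poly f" "re_poly g"
  shows "re_poly (\<lambda>z. f z * g z)"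
proof -
  obtain p q :: "complex poly" where
    p: "\<forall>z\<in>sphere 0 1. f z = Re (poly p z)" and q: "\<forall>z\<in>sphere 0 1. g z = Re (poly q z)"
    using assms unfolding re_poly_def by blast
  have "re_poly (\<lambda>z. \<Sum>i\<le>degree p. \<Sum>j\<le>degree q. Re (coeff p i * z ^ i) * Re (coeff q j * z ^ j))"
    by (intro re_poly_sum re_poly_monom_mult)
  moreover have "(\<Sum>i\<le>degree p. \<Sum>j\<le>degree q. Re (coeff p i * z ^ i) * Re (coeff q j * z ^ j)) = f z * g z"
    if "z \<in> sphere 0 1" for z
    using p q that by (simp add: sum_product poly_altdef Re_sum)
  ultimately show ?thesis
    unfolding re_poly_def by simp
qed

text \<open>Stone-Weierstrass for the algebra \<open>re_poly\<close>. It separates points because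
  both coordinates belong to it, as real parts of z and -iz.\<close>

lemma continuous_approx_Re_poly:
  fixes c :: "complex \<Rightarrow> real"
  assumes "continuous_on (sphere 0 1) c" "0 < e"
  obtains p :: "complex poly" where "Im (poly p 0) = 0"
    "\<And>z. z \<in> sphere 0 1 \<Longrightarrow> \<bar>c z - Re (poly p z)\<bar> < e"
proof -
  have "\<exists>g. re_poly g \<and> (\<forall>z\<in>sphere 0 1. \<bar>c z - g z\<bar> < e)"
  proof (rule Stone_Weierstrass_HOL)
    show "re_poly (\<lambda>z. c)" for c
      unfolding re_poly_def by (rule exI[of _ "[:of_real c:]"]) simp
    show "continuous_on (sphere 0 1) f" if f: "re_poly f" for f
    proof -
      obtain p :: "complex poly" where "\<forall>z\<in>sphere 0 1. f z = Re (poly p z)"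
        using f unfolding re_poly_def by blast
      moreover have "continuous_on (sphere 0 1) (\<lambda>z. Re (poly p z))"
        by (intro continuous_intros)
      ultimately show ?thesis
        by (metis (no_types, lifting) continuous_on_cong)
    qed
    show "\<exists>f. re_poly f \<and> f x \<noteq> f y" if "x \<in> sphere 0 1 \<and> y \<in> sphere 0 1 \<and> x \<noteq> y" for x y :: complex
    proof -
      have "re_poly (\<lambda>z. Re (a * z))" for a
        unfolding re_poly_def by (rule exI[of _ "[:0, a:]"]) (simp add: mult.commute)
      from this[of 1] this[of "-\<i>"] have "re_poly Re" "re_poly Im"
        by simp_all
      then show ?thesis
        using that complex_eq_iff by blast
    qed
  qed (use assms re_poly_add re_poly_mult in auto)
  then obtain q :: "complex poly" where q: "\<And>z. z \<in> sphere 0 1 \<Longrightarrow> \<bar>c z - Re (poly q z)\<bar> < e"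
    unfolding re_poly_def by force
  \<comment> \<open>Subtracting the imaginary constant i Im q(0) makes the value at 0 real and
    leaves the real part unchanged.\<close>
  show thesis
    by (rule that[of "q - [:\<i> * of_real (Im (poly q 0)):]"]) (use q in auto)
qed

section \<open>Approximation in the mean by continuous functions and by real parts of
  polynomials\<close>

text \<open>Regularity squeezes A between a compact K and an open U whose difference has measure
  below e. A Urysohn function for K and the complement of U agrees with the indicator of A off U -
  K.\<close>

lemma circle_indicator_approx:
  assumes "A \<in> sets circle_measure" "0 < e"
  shows "\<exists>c::complex \<Rightarrow> real. continuous_on UNIV c \<and>
           (\<integral>z. \<bar>indicator A z - c z\<bar> \<partial>circle_measure) < e"
proof -
  \<comment> \<open>The measure is pushed forward to the Borel sets of the plane, where inner and
    outer regularity apply.\<close>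
  define N where "N = distr circle_measure borel (\<lambda>z. z)"
  interpret N: finite_measure N
    unfolding N_def by (rule circle.finite_measure_distr) simp
  have N: "measure N X = measure circle_measure (X \<inter> sphere 0 1)" if "X \<in> sets borel" for X
    using that unfolding N_def by (subst measure_distr) (auto simp: vimage_def Int_def)
  have A: "A \<in> sets borel" "A \<subseteq> sphere 0 1"
    using assms(1) by (auto simp: sets_circle_measure sets_restrict_space)
  have NA: "sets N = sets borel" "emeasure N (space N) \<noteq> \<infinity>"
    unfolding N_def using N.emeasure_finite[unfolded N_def] by auto
  have e2: "ennreal (measure N A) < ennreal (measure N A + e/2)"
    using assms by (subst ennreal_less_iff) auto
  have "\<exists>U\<in>{U. A \<subseteq> U \<and> open U}. emeasure N U < ennreal (measure N A + e/2)"
    unfolding INF_less_iff[symmetric]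
    using outer_regular[OF NA A(1)] e2 by (simp add: N.emeasure_eq_measure)
  then obtain U where U: "A \<subseteq> U" "open U" "measure N U < measure N A + e/2"
    by (auto simp: N.emeasure_eq_measure ennreal_less_iff)
  have "\<exists>K\<in>{K. K \<subseteq> A \<and> compact K}. measure N A - e/2 < measure N K"
  \<comment> \<open>\<open>ennreal\<close> truncates negative numbers to 0, so a negative bound is
    treated apart; there the empty set serves as K.\<close>
  proof (cases "measure N A - e/2 < 0")
    case True
    then show ?thesis by (intro bexI[of _ "{}"]) auto
  next
    case False
    then have "ennreal (measure N A - e/2) < ennreal (measure N A)"
      using assms by (subst ennreal_less_iff) auto
    then have "\<exists>K\<in>{K. K \<subseteq> A \<and> compact K}. ennreal (measure N A - e/2) < emeasure N K"
      unfolding less_SUP_iff[symmetric]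
      using inner_regular[OF NA A(1)] by (simp add: N.emeasure_eq_measure)
    then show ?thesis
      using False by (auto simp: N.emeasure_eq_measure ennreal_less_iff)
  qed
  then obtain K where K: "K \<subseteq> A" "compact K" "measure N A - e/2 < measure N K"
    by auto
  obtain c :: "complex \<Rightarrow> real" where c: "continuous_on UNIV c"
    "\<And>z. c z \<in> closed_segment 1 0" "\<And>z. z \<in> K \<Longrightarrow> c z = 1" "\<And>z. z \<in> -U \<Longrightarrow> c z = 0"
    by (rule Urysohn[of K "-U" 1 0])
       (use U K in \<open>auto simp: closed_Compl compact_imp_closed\<close>)
  have c01: "0 \<le> c z" "c z \<le> 1" for z
    using c(2)[of z] by (auto simp: closed_segment_eq_real_ivl)
  have UK: "U - K \<in> sets borel"
    using U K by (auto intro: borel_compact)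
  have "(\<integral>z. \<bar>indicator A z - c z\<bar> \<partial>circle_measure) \<le>
      (\<integral>z. indicator ((U - K) \<inter> sphere 0 1) z \<partial>circle_measure)"
  proof (rule integral_mono)
    have UK': "(U - K) \<inter> sphere 0 1 \<in> sets circle_measure"
      using UK by (auto simp: sets_circle_measure sets_restrict_space)
    have "c \<in> borel_measurable circle_measure"
      using c(1) continuous_on_subset by (blast intro: continuous_on_circle_measurable)
    then show "integrable circle_measure (\<lambda>z. \<bar>indicator A z - c z\<bar>)"
      by (intro integrable_circle_bounded[where B = 1])
         (use assms c01 in \<open>auto intro!: AE_I2 simp: indicator_def\<close>)
    show "integrable circle_measure (indicator ((U - K) \<inter> sphere 0 1) :: complex \<Rightarrow> real)"
      using UK' by (intro integrable_circle_bounded[where B = 1]) (auto intro!: AE_I2)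
    show "\<bar>indicator A z - c z\<bar> \<le> indicator ((U - K) \<inter> sphere 0 1) z"
      if "z \<in> space circle_measure" for z
      using that c01[of z] c(3,4)[of z] U(1) K(1) by (auto simp: indicator_def)
  qed
  also have "\<dots> = measure N (U - K)"
    using UK by (simp add: N)
  also have "\<dots> = measure N U - measure N K"
    by (rule N.finite_measure_Diff) (use U K NA in \<open>auto intro: borel_compact\<close>)
  finally show ?thesis
    using c(1) U K by (intro exI[of _ c]) auto
qed

lemma L1_continuous_dense:
  fixes v :: "complex \<Rightarrow> real"
  assumes "integrable circle_measure v" "0 < e"
  shows "\<exists>c. continuous_on UNIV c \<and> (\<integral>z. \<bar>v z - c z\<bar> \<partial>circle_measure) < e"
  using assms
proof (induction arbitrary: e rule: integrable_induct)
  case (base A r)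
  define d where "d = e / (\<bar>r\<bar> + 1)"
  have d: "d > 0" "\<bar>r\<bar> * d < e" using base.prems by (auto simp: d_def field_simps)
  obtain c where c: "continuous_on UNIV c" "(\<integral>z. \<bar>indicator A z - c z\<bar> \<partial>circle_measure) < d"
    using circle_indicator_approx[OF base(1) d(1)] by blast
  have "(\<integral>z. \<bar>indicator A z *\<^sub>R r - r * c z\<bar> \<partial>circle_measure) =
      (\<integral>z. \<bar>r\<bar> * \<bar>indicator A z - c z\<bar> \<partial>circle_measure)"
    by (simp add: abs_mult[symmetric] algebra_simps)
  also have "\<dots> \<le> \<bar>r\<bar> * d"
    using c(2) by (simp add: mult_left_mono)
  finally show ?case
    using c(1) d(2) by (intro exI[of _ "\<lambda>z. r * c z"]) (auto intro!: continuous_intros)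
next
  case (add f g)
  obtain c where c: "continuous_on UNIV c" "(\<integral>z. \<bar>f z - c z\<bar> \<partial>circle_measure) < e/2"
    using add.IH(1)[of "e/2"] add.prems by auto
  obtain d where d: "continuous_on UNIV d" "(\<integral>z. \<bar>g z - d z\<bar> \<partial>circle_measure) < e/2"
    using add.IH(2)[of "e/2"] add.prems by auto
  have int: "integrable circle_measure (\<lambda>z. f z - c z)" "integrable circle_measure (\<lambda>z. g z - d z)"
    using add.hyps continuous_on_subset[OF c(1) subset_UNIV] continuous_on_subset[OF d(1) subset_UNIV]
    by (simp_all add: integrable_circle_continuous)
  have "(\<integral>z. \<bar>f z + g z - (c z + d z)\<bar> \<partial>circle_measure) \<le>
      (\<integral>z. \<bar>f z - c z\<bar> + \<bar>g z - d z\<bar> \<partial>circle_measure)"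
    using Bochner_Integration.integrable_add[OF int]
    by (intro integral_mono Bochner_Integration.integrable_add integrable_abs int)
       (auto simp: algebra_simps)
  also have "\<dots> < e"
    using c(2) d(2) int by simp
  finally show ?case
    using c(1) d(1) by (intro exI[of _ "\<lambda>z. c z + d z"]) (auto intro!: continuous_intros)
next
  case (lim f s)
  have "(\<lambda>i. \<integral>z. \<bar>f z - s i z\<bar> \<partial>circle_measure) \<longlonglongrightarrow> (\<integral>z. 0 \<partial>circle_measure)"
  proof (rule integral_dominated_convergence[where w = "\<lambda>z. 3 * \<bar>f z\<bar>"])
    show "AE z in circle_measure. (\<lambda>i. \<bar>f z - s i z\<bar>) \<longlonglongrightarrow> 0"
      using lim.hyps(2) by (intro AE_I2) (auto intro!: tendsto_eq_intros)
    \<comment> \<open>The simple approximants satisfy |s i| \<le> 2 |f|, hence the factor 3.\<close>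
    show "AE z in circle_measure. norm \<bar>f z - s i z\<bar> \<le> 3 * \<bar>f z\<bar>" for i
      using lim.hyps(3)[of _ i] by (intro AE_I2) fastforce
  qed (use lim.hyps in auto)
  then have "\<forall>\<^sub>F i in sequentially. (\<integral>z. \<bar>f z - s i z\<bar> \<partial>circle_measure) < e/2"
    using lim.prems by (intro order_tendstoD) auto
  then obtain i where i: "(\<integral>z. \<bar>f z - s i z\<bar> \<partial>circle_measure) < e/2"
    by (auto simp: eventually_sequentially)
  obtain c where c: "continuous_on UNIV c" "(\<integral>z. \<bar>s i z - c z\<bar> \<partial>circle_measure) < e/2"
    using lim.IH[of "e/2" i] lim.prems by auto
  have int: "integrable circle_measure (\<lambda>z. f z - s i z)" "integrable circle_measure (\<lambda>z. s i z - c z)"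
    "integrable circle_measure (\<lambda>z. f z - c z)"
    using lim.hyps continuous_on_subset[OF c(1) subset_UNIV]
    by (simp_all add: integrable_circle_continuous)
  have "(\<integral>z. \<bar>f z - c z\<bar> \<partial>circle_measure) \<le>
      (\<integral>z. \<bar>f z - s i z\<bar> + \<bar>s i z - c z\<bar> \<partial>circle_measure)"
    by (intro integral_mono Bochner_Integration.integrable_add integrable_abs int) auto
  also have "\<dots> < e"
    using c(2) i int by simp
  finally show ?case
    using c(1) by blast
qed

text \<open>Truncate v at n, approximate the truncation in the mean by a continuous function with
  values in [0, n], and that one uniformly by Re p. Between functions with values in [0, n] the
  squared distance is at most n times the distance, which turns the \<open>L\<^sup>1\<close>
  estimate into an \<open>L\<^sup>2\<close> one.\<close>

lemma L2_approx_Re_poly: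
  fixes v :: "complex \<Rightarrow> real"
  assumes v[measurable]: "v \<in> borel_measurable circle_measure" and v0: "\<And>z. 0 \<le> v z"
    and v2: "integrable circle_measure (\<lambda>z. (v z)\<^sup>2)" and e: "0 < e"
  shows "\<exists>p::complex poly. Im (poly p 0) = 0 \<and> (\<forall>z\<in>sphere 0 1. - 1 \<le> Re (poly p z)) \<and>
           (\<integral>z. (v z - Re (poly p z))\<^sup>2 \<partial>circle_measure) < e"
proof -
  define T where "T n z = min (v z) (real n)" for n :: nat and z
  have [measurable]: "T n \<in> borel_measurable circle_measure" for n
    unfolding T_def by measurable
  have T: "0 \<le> T n z" "T n z \<le> v z" "T n z \<le> real n" for n z
    using v0[of z] by (auto simp: T_def)
  have vT: "norm ((v z - T n z)\<^sup>2) \<le> (v z)\<^sup>2" for n z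
    using T[of n z] by (simp add: power_mono)
  have "(\<lambda>n. \<integral>z. (v z - T n z)\<^sup>2 \<partial>circle_measure) \<longlonglongrightarrow> (\<integral>z. 0 \<partial>circle_measure)"
  proof (rule integral_dominated_convergence[where w = "\<lambda>z. (v z)\<^sup>2"])
    show "AE z in circle_measure. (\<lambda>n. (v z - T n z)\<^sup>2) \<longlonglongrightarrow> 0"
    proof (intro AE_I2 tendsto_eventually)
      fix z
      obtain N :: nat where N: "v z \<le> real N" using real_arch_simple by blast
      show "\<forall>\<^sub>F n in sequentially. (v z - T n z)\<^sup>2 = 0"
        using eventually_ge_at_top[of N] by eventually_elim (use N in \<open>auto simp: T_def\<close>)
    qed
  qed (use v2 vT in auto)
  then have "\<forall>\<^sub>F n in sequentially. (\<integral>z. (v z - T n z)\<^sup>2 \<partial>circle_measure) < e/8"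
    using e by (intro order_tendstoD) auto
  then obtain n where n: "(\<integral>z. (v z - T n z)\<^sup>2 \<partial>circle_measure) < e/8"
    by (auto simp: eventually_sequentially)
  have Tint: "integrable circle_measure (T n)"
    using T by (intro integrable_circle_bounded[where B = "real n"]) (auto intro!: AE_I2)
  \<comment> \<open>The final estimate adds 2 (e/8) for the truncation, 4 (e/8) for the continuous
    function and 4 (e/16) for the polynomial. It is strict because the truncation error is strictly
    below e/8.\<close>
  define d where "d = e / (8 * (real n + 1))"
  have d: "0 < d" "real n * d \<le> e/8" using e by (auto simp: d_def field_simps)
  obtain c0 where c0: "continuous_on UNIV c0" "(\<integral>z. \<bar>T n z - c0 z\<bar> \<partial>circle_measure) < d"
    using L1_continuous_dense[OF Tint d(1)] by blast
  \<comment> \<open>Since \<open>T n\<close> takes values in [0, n], clamping \<open>c0\<close> to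
    that interval cannot increase the distance to \<open>T n\<close>.\<close>
  define c where "c z = max 0 (min (c0 z) (real n))" for z
  have c: "continuous_on (sphere 0 1) c"
    unfolding c_def
    by (intro continuous_intros continuous_on_subset[OF c0(1) subset_UNIV])
  have c01: "0 \<le> c z" "c z \<le> real n" for z
    by (auto simp: c_def)
  \<comment> \<open>The bound h \<le> 1 has two uses: h^2 \<le> h, and Re p \<ge> -1 because c is
    nonnegative.\<close>
  define h where "h = min 1 (e/16)"
  have h: "0 < h" "h \<le> 1" "h \<le> e/16" using e by (auto simp: h_def)
  obtain p :: "complex poly" where p: "Im (poly p 0) = 0"
    "\<And>z. z \<in> sphere 0 1 \<Longrightarrow> \<bar>c z - Re (poly p z)\<bar> < h"
    using continuous_approx_Re_poly[OF c h(1)] by blast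
  have int: "integrable circle_measure (\<lambda>z. (v z - T n z)\<^sup>2)"
    by (rule Bochner_Integration.integrable_bound[OF v2]) (use vT in auto)
  have int': "integrable circle_measure (\<lambda>z. \<bar>T n z - c0 z\<bar>)"
    using Tint integrable_circle_continuous[OF continuous_on_subset[OF c0(1) subset_UNIV]] by simp
  have "(\<integral>z. (v z - Re (poly p z))\<^sup>2 \<partial>circle_measure) \<le>
     (\<integral>z. 2 * (v z - T n z)\<^sup>2 + 4 * (real n * \<bar>T n z - c0 z\<bar>) + 4 * h \<partial>circle_measure)"
  proof (rule integral_mono)
    show "integrable circle_measure
       (\<lambda>z. 2 * (v z - T n z)\<^sup>2 + 4 * (real n * \<bar>T n z - c0 z\<bar>) + 4 * h)"
      using int int' by simp
    have *: "(v z - Re (poly p z))\<^sup>2 \<le> 2 * (v z - T n z)\<^sup>2 + 4 * (real n * \<bar>T n z - c0 z\<bar>) + 4 * h"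
      if "z \<in> space circle_measure" for z
    proof -
      have sq: "(a + b)\<^sup>2 \<le> 2 * a\<^sup>2 + 2 * b\<^sup>2" for a b :: real
        using zero_le_power2[of "a - b"] by (simp add: power2_eq_square algebra_simps)
      have "\<bar>c z - Re (poly p z)\<bar> \<le> h" using p(2)[of z] that by auto
      then have "(c z - Re (poly p z))\<^sup>2 \<le> h\<^sup>2"
        by (rule power2_le_iff_abs_le[THEN iffD2, rotated]) (use h in auto)
      also have "\<dots> \<le> h" using h by (simp add: power2_eq_square mult_left_le)
      finally have 1: "(c z - Re (poly p z))\<^sup>2 \<le> h" .
      have "(T n z - c z)\<^sup>2 = \<bar>T n z - c z\<bar> * \<bar>T n z - c z\<bar>"
        by (simp add: power2_eq_square flip: abs_mult)
      also have "\<dots> \<le> real n * \<bar>T n z - c0 z\<bar>"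
        by (intro mult_mono) (use T[of n z] in \<open>auto simp: c_def\<close>)
      finally have 2: "(T n z - c z)\<^sup>2 \<le> real n * \<bar>T n z - c0 z\<bar>" .
      show ?thesis
        using sq[of "v z - T n z" "(T n z - c z) + (c z - Re (poly p z))"]
              sq[of "T n z - c z" "c z - Re (poly p z)"] 1 2
        by (simp add: add_diff_eq)
    qed
    then show "(v z - Re (poly p z))\<^sup>2 \<le> 2 * (v z - T n z)\<^sup>2 + 4 * (real n * \<bar>T n z - c0 z\<bar>) + 4 * h"
      if "z \<in> space circle_measure" for z using that .
    show "integrable circle_measure (\<lambda>z. (v z - Re (poly p z))\<^sup>2)"
      by (rule Bochner_Integration.integrable_bound[OF 
            \<open>integrable circle_measure (\<lambda>z. 2 * (v z - T n z)\<^sup>2 + 4 * (real n * \<bar>T n z - c0 z\<bar>) + 4 * h)\<close>])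
         (use * in \<open>auto intro!: AE_I2 order_trans[OF * abs_ge_self]\<close>)
  qed
  also have "\<dots> < e"
  proof -
    have "real n * (\<integral>z. \<bar>T n z - c0 z\<bar> \<partial>circle_measure) \<le> e/8"
      using c0(2) d(2) mult_left_mono[of "\<integral>z. \<bar>T n z - c0 z\<bar> \<partial>circle_measure" d "real n"] by linarith
    then show ?thesis
      using int int' n h by simp
  qed
  finally have "(\<integral>z. (v z - Re (poly p z))\<^sup>2 \<partial>circle_measure) < e" .
  moreover have "- 1 \<le> Re (poly p z)" if "z \<in> sphere 0 1" for z
    using p(2)[OF that] c01(1)[of z] h(2) by linarith
  ultimately show ?thesis using p(1) by blast
qed

section \<open>Harmonic conjugation through almost everywhere convergence\<close>

text \<open>For nonnegative terms sum and integral commute, so the sum has a finite integral and is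
  finite almost everywhere.\<close>

lemma AE_summable_integral:
  fixes u :: "nat \<Rightarrow> 'a \<Rightarrow> real"
  assumes "\<And>j. integrable M (u j)" "\<And>j z. 0 \<le> u j z" "summable (\<lambda>j. \<integral>z. u j z \<partial>M)"
  shows "AE z in M. summable (\<lambda>j. u j z)"
proof -
  have [measurable]: "u j \<in> borel_measurable M" for j using assms(1) by auto
  have "(\<integral>\<^sup>+z. (\<Sum>j. ennreal (u j z)) \<partial>M) = (\<Sum>j. \<integral>\<^sup>+z. ennreal (u j z) \<partial>M)"
    by (rule nn_integral_suminf) simp
  also have "\<dots> = (\<Sum>j. ennreal (\<integral>z. u j z \<partial>M))"
    using assms by (simp add: nn_integral_eq_integral)
  also have "\<dots> \<noteq> \<infinity>"
    using assms by (simp add: suminf_ennreal2)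
  finally have "AE z in M. (\<Sum>j. ennreal (u j z)) \<noteq> \<infinity>"
    by (intro nn_integral_noteq_infinite) auto
  then show ?thesis
    by eventually_elim (use assms(2) in \<open>auto intro: summable_suminf_not_top\<close>)
qed

text \<open>
  The limit \<open>F\<close> is \<open>v\<close> plus \<open>\<i>\<close> times its harmonic conjugate.  The lower bound on the real parts
  of the approximants is what keeps their exponentials uniformly bounded.
\<close>

lemma analytic_completion:
  fixes v :: "complex \<Rightarrow> real"
  assumes v[measurable]: "v \<in> borel_measurable circle_measure" and v0: "\<And>z. 0 \<le> v z"
    and v2: "integrable circle_measure (\<lambda>z. (v z)\<^sup>2)"
  obtains F and p :: "nat \<Rightarrow> complex poly" where
    "F \<in> borel_measurable circle_measure"
    "AE z in circle_measure. Re (F z) = v z"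
    "\<And>j z. z \<in> sphere 0 1 \<Longrightarrow> - 1 \<le> Re (poly (p j) z)"
    "AE z in circle_measure. (\<lambda>j. poly (p j) z) \<longlonglongrightarrow> F z"
proof -
  \<comment> \<open>The rate (1/4)^j stays summable after multiplication by the weight 2^j used
    below.\<close>
  have "\<forall>j. \<exists>p::complex poly. Im (poly p 0) = 0 \<and> (\<forall>z\<in>sphere 0 1. - 1 \<le> Re (poly p z)) \<and>
           (\<integral>z. (v z - Re (poly p z))\<^sup>2 \<partial>circle_measure) < (1/4)^j"
    using L2_approx_Re_poly[OF v v0 v2] by simp
  then obtain p :: "nat \<Rightarrow> complex poly" where p: "\<And>j. Im (poly (p j) 0) = 0"
    "\<And>j z. z \<in> sphere 0 1 \<Longrightarrow> - 1 \<le> Re (poly (p j) z)"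
    "\<And>j. (\<integral>z. (v z - Re (poly (p j) z))\<^sup>2 \<partial>circle_measure) < (1/4)^j"
    by metis
  have sq: "(a - b)\<^sup>2 \<le> 2 * a\<^sup>2 + 2 * b\<^sup>2" for a b :: real
    using zero_le_power2[of "a + b"] by (simp add: power2_eq_square algebra_simps)
  have cont: "integrable circle_measure (\<lambda>z. (Re (poly q z))\<^sup>2)" 
    "integrable circle_measure (\<lambda>z. (Im (poly q z))\<^sup>2)" for q :: "complex poly"
    by (intro integrable_circle_continuous continuous_intros)+
  have int: "integrable circle_measure (\<lambda>z. (v z - Re (poly (p j) z))\<^sup>2)" for j
  proof (rule Bochner_Integration.integrable_bound)
    show "integrable circle_measure (\<lambda>z. 2 * (v z)\<^sup>2 + 2 * (Re (poly (p j) z))\<^sup>2)"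
      using v2 cont by simp
  qed (use sq in \<open>auto intro!: AE_I2\<close>)
  define D where "D j = p (Suc j) - p j" for j
  have intD: "integrable circle_measure (\<lambda>z. 2^j * (cmod (poly (D j) z))\<^sup>2)" for j
    by (intro integrable_circle_continuous continuous_intros)
  \<comment> \<open>Both parts of \<open>D j\<close> are controlled by its real part, since
    \<open>D j\<close> is real at 0. The weight makes summability of these squares strong enough to
    give absolute summability of the increments themselves.\<close>
  have D: "(\<integral>z. 2^j * (cmod (poly (D j) z))\<^sup>2 \<partial>circle_measure) \<le> 8 * (1/2)^j" for j
  proof -
    have "(\<integral>z. (Re (poly (D j) z))\<^sup>2 \<partial>circle_measure) \<le>
       (\<integral>z. 2 * (v z - Re (poly (p j) z))\<^sup>2 + 2 * (v z - Re (poly (p (Suc j)) z))\<^sup>2 \<partial>circle_measure)"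
    proof (rule integral_mono)
      show "(Re (poly (D j) z))\<^sup>2 \<le>
         2 * (v z - Re (poly (p j) z))\<^sup>2 + 2 * (v z - Re (poly (p (Suc j)) z))\<^sup>2" for z
        using sq[of "v z - Re (poly (p j) z)" "v z - Re (poly (p (Suc j)) z)"]
        by (simp add: D_def)
    qed (use cont int in auto)
    also have "\<dots> \<le> 4 * (1/4)^j"
    proof -
      have "(1/4::real) ^ Suc j \<le> (1/4) ^ j" by (simp add: power_decreasing)
      moreover have "(\<integral>z. 2 * (v z - Re (poly (p j) z))\<^sup>2 + 2 * (v z - Re (poly (p (Suc j)) z))\<^sup>2 \<partial>circle_measure) =
          2 * (\<integral>z. (v z - Re (poly (p j) z))\<^sup>2 \<partial>circle_measure) + 2 * (\<integral>z. (v z - Re (poly (p (Suc j)) z))\<^sup>2 \<partial>circle_measure)"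
        using int by simp
      ultimately show ?thesis
        using p(3)[of j] p(3)[of "Suc j"] by linarith
    qed
    finally have Re: "(\<integral>z. (Re (poly (D j) z))\<^sup>2 \<partial>circle_measure) \<le> 4 * (1/4)^j" .
    have "(\<integral>z. (Im (poly (D j) z))\<^sup>2 \<partial>circle_measure) \<le> (\<integral>z. (Re (poly (D j) z))\<^sup>2 \<partial>circle_measure)"
      by (rule integral_Im_poly_le) (simp add: D_def p(1))
    then have "(\<integral>z. (cmod (poly (D j) z))\<^sup>2 \<partial>circle_measure) \<le> 8 * (1/4)^j"
      using Re cont by (simp add: cmod_power2)
    then have "2^j * (\<integral>z. (cmod (poly (D j) z))\<^sup>2 \<partial>circle_measure) \<le> 2^j * (8 * (1/4)^j)"
      by (intro mult_left_mono) auto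
    also have "\<dots> = 8 * (1/2)^j"
      by (simp add: power_mult_distrib[symmetric] mult.left_commute)
    finally show ?thesis by simp
  qed
  have "AE z in circle_measure. summable (\<lambda>j. 2^j * (cmod (poly (D j) z))\<^sup>2)"
  proof (rule AE_summable_integral)
    show "summable (\<lambda>j. \<integral>z. 2^j * (cmod (poly (D j) z))\<^sup>2 \<partial>circle_measure)"
      by (rule summable_comparison_test_ev[where g = "\<lambda>j. 8 * (1/2)^j"])
         (use D in \<open>auto intro!: always_eventually summable_mult summable_geometric simp: abs_of_nonneg\<close>)
  qed (use intD in auto)
  then have conv: "AE z in circle_measure. convergent (\<lambda>j. poly (p j) z)"
  proof eventually_elim
    case (elim z)
    have "summable (\<lambda>j. poly (D j) z)"
    proof (rule summable_comparison_test_ev)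
      show "summable (\<lambda>j. (1/2)^j + 2^j * (cmod (poly (D j) z))\<^sup>2)"
        using elim by (intro summable_add summable_geometric) auto
      \<comment> \<open>Either |w| is at most (1/2)^j, or 2^j |w| > 1 and then |w| \<le> 2^j
        |w|^2.\<close>
      have "cmod w \<le> (1/2)^j + 2^j * (cmod w)\<^sup>2" for w j
      proof (cases "cmod w \<le> (1/2)^j")
        case False
        then have "1 \<le> 2^j * cmod w"
          by (simp add: field_simps power_divide)
        then have "cmod w * 1 \<le> cmod w * (2^j * cmod w)"
          by (intro mult_left_mono) auto
        then show ?thesis
          by (simp add: power2_eq_square algebra_simps add_increasing)
      qed (simp add: add_increasing2)
      then show "\<forall>\<^sub>F j in sequentially. norm (poly (D j) z) \<le> (1/2)^j + 2^j * (cmod (poly (D j) z))\<^sup>2"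
        by simp
    qed
    then have "convergent (\<lambda>n. poly (p 0) z + (\<Sum>j<n. poly (D j) z))"
      by (intro convergent_add convergent_const) (simp add: summable_iff_convergent)
    moreover have "(\<Sum>j<n. poly (D j) z) = poly (p n) z - poly (p 0) z" for n
      unfolding D_def poly_diff by (rule sum_lessThan_telescope)
    ultimately show ?case by simp
  qed
  have "AE z in circle_measure. summable (\<lambda>j. (v z - Re (poly (p j) z))\<^sup>2)"
  proof (rule AE_summable_integral)
    show "summable (\<lambda>j. \<integral>z. (v z - Re (poly (p j) z))\<^sup>2 \<partial>circle_measure)"
      by (rule summable_comparison_test_ev[where g = "\<lambda>j. (1/4)^j"])
         (use p(3) in \<open>auto intro!: always_eventually summable_geometric less_imp_le simp: abs_of_nonneg\<close>)
  qed (use int in auto)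
  then have Re: "AE z in circle_measure. (\<lambda>j. Re (poly (p j) z)) \<longlonglongrightarrow> v z"
  proof eventually_elim
    case (elim z)
    then have "(\<lambda>j. (v z - Re (poly (p j) z))\<^sup>2) \<longlonglongrightarrow> 0"
      by (rule summable_LIMSEQ_zero)
    then have "(\<lambda>j. v z - (v z - Re (poly (p j) z))) \<longlonglongrightarrow> v z - 0"
      by (intro tendsto_diff tendsto_const) simp
    then show ?case by simp
  qed
  \<comment> \<open>Where the sequence diverges \<open>lim\<close> is unspecified, but that happens
    only on a null set.\<close>
  define F where "F z = lim (\<lambda>j. poly (p j) z)" for z
  have F: "AE z in circle_measure. (\<lambda>j. poly (p j) z) \<longlonglongrightarrow> F z"
    using conv by eventually_elim (simp add: F_def convergent_LIMSEQ_iff)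
  show thesis
  proof
    show "F \<in> borel_measurable circle_measure"
      unfolding F_def by measurable
    show "AE z in circle_measure. Re (F z) = v z"
      using F Re by eventually_elim (metis LIMSEQ_unique tendsto_Re)
  qed (use p(2) F in auto)
qed

section \<open>Bounded analytic multipliers\<close>

text \<open>p is bounded on the circle, so the exponential series composed with p converges
  uniformly there, and its partial sums are polynomials in z.\<close>

lemma exp_poly_approx:
  fixes p :: "complex poly"
  assumes "0 < e"
  obtains q :: "complex poly" where "\<And>z. z \<in> sphere 0 1 \<Longrightarrow> cmod (exp (poly p z) - poly q z) < e"
proof -
  have "compact ((\<lambda>z. poly p z) ` sphere 0 1)"
    by (intro compact_continuous_image compact_sphere continuous_intros)
  then obtain B where B: "\<And>z. z \<in> sphere 0 1 \<Longrightarrow> cmod (poly p z) \<le> B"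
    using compact_imp_bounded bounded_iff by (metis image_eqI)
  have "uniform_limit (sphere 0 1) (\<lambda>n z. \<Sum>i<n. poly p z ^ i /\<^sub>R fact i)
          (\<lambda>z. \<Sum>i. poly p z ^ i /\<^sub>R fact i) sequentially"
  proof (rule Weierstrass_m_test)
    show "norm (poly p z ^ i /\<^sub>R fact i) \<le> B ^ i /\<^sub>R fact i" if "z \<in> sphere 0 1" for i z
      using B[OF that] by (simp add: norm_power divide_right_mono power_mono divide_inverse mult.commute)
  qed (rule summable_exp_generic)
  then have "\<forall>\<^sub>F n in sequentially. \<forall>z\<in>sphere 0 1.
      dist (\<Sum>i<n. poly p z ^ i /\<^sub>R fact i) (exp (poly p z)) < e"
    using assms unfolding uniform_limit_iff exp_def by blast
  then obtain n where n: "\<And>z. z \<in> sphere 0 1 \<Longrightarrow>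
      dist (\<Sum>i<n. poly p z ^ i /\<^sub>R fact i) (exp (poly p z)) < e"
    using eventually_happens'[OF sequentially_bot] by blast
  show thesis
  proof
    show "cmod (exp (poly p z) - poly (\<Sum>i<n. smult (of_real (inverse (fact i))) (p ^ i)) z) < e"
      if "z \<in> sphere 0 1" for z
      using n[OF that] by (simp add: poly_sum dist_norm norm_minus_commute scaleR_conv_of_real)
  qed
qed

text \<open>The square root of |f| is square integrable, which is what
  \<open>analytic_completion\<close> asks for, and still grows fast enough that exp of its negative
  multiples tames f. The polynomials \<open>q n j\<close> carry a uniform bound so that dominated
  convergence can move \<open>k n\<close> into an invariant closed subspace.\<close>

lemma bounded_analytic_multipliers:
  assumes f: "integrable circle_measure (f :: complex \<Rightarrow> complex)"
  obtains k :: "nat \<Rightarrow> complex \<Rightarrow> complex" and q :: "nat \<Rightarrow> nat \<Rightarrow> complex poly" where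
    "\<And>n. k n \<in> borel_measurable circle_measure"
    "\<And>n. AE z in circle_measure. cmod (k n z) \<le> 1"
    "\<And>n. AE z in circle_measure. cmod (k n z * f z) \<le> 2 * (real (Suc n))\<^sup>2"
    "AE z in circle_measure. (\<lambda>n. k n z) \<longlonglongrightarrow> 1"
    "\<And>n j z. z \<in> sphere 0 1 \<Longrightarrow> cmod (poly (q n j) z) \<le> 4"
    "\<And>n. AE z in circle_measure. (\<lambda>j. poly (q n j) z) \<longlonglongrightarrow> k n z"
proof -
  have [measurable]: "f \<in> borel_measurable circle_measure" using f by auto
  define v where "v z = sqrt (cmod (f z))" for z
  have v: "v \<in> borel_measurable circle_measure" "\<And>z. 0 \<le> v z" "\<And>z. (v z)\<^sup>2 = cmod (f z)"
    unfolding v_def by auto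
  have v2: "integrable circle_measure (\<lambda>z. (v z)\<^sup>2)"
    unfolding v(3) using f by (rule integrable_norm)
  obtain F and p :: "nat \<Rightarrow> complex poly" where F[measurable]: "F \<in> borel_measurable circle_measure"
    and ReF: "AE z in circle_measure. Re (F z) = v z"
    and p1: "\<And>j z. z \<in> sphere 0 1 \<Longrightarrow> - 1 \<le> Re (poly (p j) z)"
    and pF: "AE z in circle_measure. (\<lambda>j. poly (p j) z) \<longlonglongrightarrow> F z"
    using analytic_completion[OF v(1,2) v2] by blast
  define t where "t n = 1 / real (Suc n)" for n
  define k where "k n z = exp (- (of_real (t n) * F z))" for n z
  have t: "0 \<le> t n" "t n \<le> 1" for n by (auto simp: t_def)
  \<comment> \<open>The error 1 / (j + 1) tends to 0, and being at most 1 it also keeps the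
    polynomials uniformly bounded.\<close>
  have "\<exists>q::complex poly. \<forall>z\<in>sphere 0 1. cmod (exp (- (of_real (t n) * poly (p j) z)) - poly q z) < 1 / Suc j" for n j
  proof -
    obtain q :: "complex poly" where
      "\<And>z. z \<in> sphere 0 1 \<Longrightarrow> cmod (exp (poly (smult (- of_real (t n)) (p j)) z) - poly q z) < 1 / Suc j"
      by (rule exp_poly_approx[of "1 / Suc j" "smult (- of_real (t n)) (p j)"]) auto
    then show ?thesis by (intro exI[of _ q]) auto
  qed
  then obtain q :: "nat \<Rightarrow> nat \<Rightarrow> complex poly" where
    q: "\<And>n j z. z \<in> sphere 0 1 \<Longrightarrow> cmod (exp (- (of_real (t n) * poly (p j) z)) - poly (q n j) z) < 1 / Suc j"
    by metis
  show thesis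
  proof
    show "k n \<in> borel_measurable circle_measure" for n
      unfolding k_def by measurable
    show "AE z in circle_measure. cmod (k n z) \<le> 1" for n
      using ReF by eventually_elim (use t v(2) in \<open>simp add: k_def\<close>)
    show "AE z in circle_measure. cmod (k n z * f z) \<le> 2 * (real (Suc n))\<^sup>2" for n
      using ReF
    proof eventually_elim
      case (elim z)
      \<comment> \<open>In terms of x, |k n| = exp (-x) and |f| = (n + 1)^2 x^2, so the claim
        becomes x^2 exp (-x) \<le> 2, a consequence of x^2 / 2 \<le> exp x.\<close>
      define x where "x = t n * v z"
      have "0 \<le> x" using t v(2) by (simp add: x_def)
      then have "x\<^sup>2 / 2 \<le> exp x"
        using exp_lower_Taylor_quadratic[of x] by linarith
      then have "x\<^sup>2 * exp (- x) \<le> 2"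
        by (simp add: exp_minus field_simps)
      then have "(real (Suc n))\<^sup>2 * (x\<^sup>2 * exp (- x)) \<le> (real (Suc n))\<^sup>2 * 2"
        by (intro mult_left_mono) auto
      moreover have "(real (Suc n))\<^sup>2 * x\<^sup>2 = cmod (f z)"
        by (simp add: x_def t_def power_mult_distrib power_divide v(3) del: of_nat_Suc)
      ultimately have "cmod (f z) * exp (- x) \<le> (real (Suc n))\<^sup>2 * 2"
        by (simp only: mult.assoc[symmetric])
      then show ?case
        using elim by (simp add: k_def norm_mult x_def mult.commute)
    qed
    show "AE z in circle_measure. (\<lambda>n. k n z) \<longlonglongrightarrow> 1"
    proof (rule AE_I2)
      fix z
      have "t \<longlonglongrightarrow> 0"
        unfolding t_def by (rule lim_1_over_n[THEN LIMSEQ_Suc])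
      then have "(\<lambda>n. exp (- (of_real (t n) * F z))) \<longlonglongrightarrow> exp (- (of_real 0 * F z))"
        by (intro tendsto_intros)
      then show "(\<lambda>n. k n z) \<longlonglongrightarrow> 1" by (simp add: k_def)
    qed
    show "cmod (poly (q n j) z) \<le> 4" if z: "z \<in> sphere 0 1" for n j z
    proof -
      \<comment> \<open>The constant 4 is 3 + 1: the exponential has modulus at most e \<le> 3,
        because Re p \<ge> -1 and t n \<le> 1, and the approximation error is at most 1.\<close>
      have "- (t n * Re (poly (p j) z)) \<le> t n * 1"
        using mult_left_mono[OF p1[OF z, of j] t(1)[of n]] by simp
      also have "\<dots> \<le> 1" using t by simp
      finally have "exp (- (t n * Re (poly (p j) z))) \<le> exp 1" by simp
      also have "\<dots> \<le> 3" by (rule exp_le)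
      finally have "cmod (exp (- (of_real (t n) * poly (p j) z))) \<le> 3" by simp
      moreover have "cmod (exp (- (of_real (t n) * poly (p j) z)) - poly (q n j) z) \<le> 1"
        using q[OF z, of n j] by (rule order_trans[OF less_imp_le]) simp
      ultimately show ?thesis
        using norm_triangle_sub[of "poly (q n j) z" "exp (- (of_real (t n) * poly (p j) z))"]
        by (simp add: norm_minus_commute)
    qed
    show "AE z in circle_measure. (\<lambda>j. poly (q n j) z) \<longlonglongrightarrow> k n z" for n
      using pF AE_space
    proof eventually_elim
      case (elim z)
      have "(\<lambda>j. exp (- (of_real (t n) * poly (p j) z))) \<longlonglongrightarrow> k n z"
        unfolding k_def by (intro tendsto_intros elim)
      moreover have "(\<lambda>j. exp (- (of_real (t n) * poly (p j) z)) - poly (q n j) z) \<longlonglongrightarrow> 0"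
      proof (rule Lim_null_comparison)
        show "\<forall>\<^sub>F j in sequentially. norm (exp (- (of_real (t n) * poly (p j) z)) - poly (q n j) z) \<le> 1 / Suc j"
          using q elim by (intro always_eventually allI less_imp_le) auto
        show "(\<lambda>j. 1 / real (Suc j)) \<longlonglongrightarrow> 0"
          by (rule lim_1_over_n[THEN LIMSEQ_Suc])
      qed
      ultimately show ?case
        using tendsto_diff by fastforce
    qed
  qed
qed

section \<open>Gauge norms\<close>

lemma LinfI:
  "f \<in> borel_measurable circle_measure \<Longrightarrow> AE z in circle_measure. cmod (f z) \<le> C \<Longrightarrow> f \<in> Linf"
  unfolding Linf_def by blast

lemma Linf_measurable: "f \<in> Linf \<Longrightarrow> f \<in> borel_measurable circle_measure"
  by (simp add: Linf_def)

lemma LinfE: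
  assumes "f \<in> Linf"
  obtains C where "0 < C" "AE z in circle_measure. cmod (f z) \<le> C"
proof -
  obtain C where "AE z in circle_measure. cmod (f z) \<le> C"
    using assms by (auto simp: Linf_def)
  then have "AE z in circle_measure. cmod (f z) \<le> max C 1"
    by eventually_elim simp
  then show thesis by (rule that[rotated]) simp
qed

lemma Linf_add:
  assumes "f \<in> Linf" "g \<in> Linf"
  shows "(\<lambda>z. f z + g z) \<in> Linf"
proof -
  obtain C where C: "AE z in circle_measure. cmod (f z) \<le> C"
    using assms(1) by (rule LinfE)
  obtain D where D: "AE z in circle_measure. cmod (g z) \<le> D"
    using assms(2) by (rule LinfE)
  show ?thesis
  proof (rule LinfI)
    show "AE z in circle_measure. cmod (f z + g z) \<le> C + D"
      using C D by eventually_elim (rule norm_triangle_mono)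
  qed (use assms[THEN Linf_measurable] in measurable)
qed

lemma Linf_mult:
  assumes "f \<in> Linf" "g \<in> Linf"
  shows "(\<lambda>z. f z * g z) \<in> Linf"
proof -
  obtain C where C: "0 < C" "AE z in circle_measure. cmod (f z) \<le> C"
    using assms(1) by (rule LinfE)
  obtain D where D: "AE z in circle_measure. cmod (g z) \<le> D"
    using assms(2) by (rule LinfE)
  show ?thesis
  proof (rule LinfI)
    show "AE z in circle_measure. cmod (f z * g z) \<le> C * D"
      using C(2) D by eventually_elim (use C(1) in \<open>simp add: norm_mult mult_mono'\<close>)
  qed (use assms[THEN Linf_measurable] in measurable)
qed

lemma Linf_const: "(\<lambda>_. c) \<in> Linf"
  by (rule LinfI[where C = "cmod c"]) auto

lemma Linf_diff: "f \<in> Linf \<Longrightarrow> g \<in> Linf \<Longrightarrow> (\<lambda>z. f z - g z) \<in> Linf"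
  using Linf_add[of f "\<lambda>z. -1 * g z"] Linf_mult[OF Linf_const, of g "-1"] by simp

lemma Linf_integrable: "f \<in> Linf \<Longrightarrow> integrable circle_measure f"
  by (meson LinfE Linf_measurable integrable_circle_bounded)

lemma simple_function_Linf:
  assumes "simple_function circle_measure (s :: complex \<Rightarrow> real)"
  shows "(\<lambda>z. complex_of_real (s z)) \<in> Linf"
proof -
  have [measurable]: "s \<in> borel_measurable circle_measure"
    using assms by (rule borel_measurable_simple_function)
  have "finite (s ` space circle_measure)"
    using assms by (rule simple_functionD)
  then have "\<bar>s z\<bar> \<le> Max (abs ` s ` space circle_measure)" if "z \<in> space circle_measure" for z
    using that by (intro Max_ge) auto
  then show ?thesis
    by (intro LinfI[where C = "Max (abs ` s ` space circle_measure)"] AE_I2) simp_all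
qed

lemma gauge_normD:
  assumes "normalized_gauge_norm \<alpha>"
  shows "f \<in> Linf \<Longrightarrow> 0 \<le> \<alpha> f"
    "f \<in> Linf \<Longrightarrow> \<alpha> f = 0 \<longleftrightarrow> (AE z in circle_measure. f z = 0)"
    "f \<in> Linf \<Longrightarrow> \<alpha> (\<lambda>z. c * f z) = cmod c * \<alpha> f"
    "f \<in> Linf \<Longrightarrow> g \<in> Linf \<Longrightarrow> \<alpha> (\<lambda>z. f z + g z) \<le> \<alpha> f + \<alpha> g"
    "\<alpha> (\<lambda>_. 1) = 1"
    "f \<in> Linf \<Longrightarrow> \<alpha> (\<lambda>z. complex_of_real (cmod (f z))) = \<alpha> f"
  using assms unfolding normalized_gauge_norm_def Linf_norm_def by auto

text \<open>The difference lies in the null space of \<alpha>, so the triangle inequality gives both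
  directions.\<close>

lemma gauge_norm_AE_cong:
  assumes "normalized_gauge_norm \<alpha>" "f \<in> Linf" "g \<in> Linf" "AE z in circle_measure. f z = g z"
  shows "\<alpha> f = \<alpha> g"
proof -
  have *: "\<alpha> f \<le> \<alpha> g" if fg: "f \<in> Linf" "g \<in> Linf" "AE z in circle_measure. f z = g z" for f g
  proof -
    have "\<alpha> (\<lambda>z. g z + (f z - g z)) \<le> \<alpha> g + \<alpha> (\<lambda>z. f z - g z)"
      by (intro gauge_normD(4)[OF assms(1)] Linf_diff fg)
    moreover have "\<alpha> (\<lambda>z. f z - g z) = 0"
      using gauge_normD(2)[OF assms(1) Linf_diff[OF fg(1,2)]] fg(3) by auto
    ultimately show ?thesis by simp
  qed
  show ?thesis
    using *[OF assms(2-4)] *[OF assms(3,2)] assms(4) by (force simp: eq_commute)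
qed

text \<open>A function with values in \<open>[0, 1]\<close> is the mean of two unimodular functions.\<close>

lemma gauge_norm_le_one:
  assumes \<alpha>: "normalized_gauge_norm \<alpha>" and t[measurable]: "t \<in> borel_measurable circle_measure"
    and t01: "AE z in circle_measure. 0 \<le> t z \<and> t z \<le> 1"
  shows "\<alpha> (\<lambda>z. complex_of_real (t z)) \<le> 1"
proof -
  \<comment> \<open>t lies in [0, 1] only almost everywhere. Clamping gives a version for which u
    has modulus 1 at every point, so that |u| is literally the constant 1 and \<alpha>(u) =
    \<alpha>(1) = 1.\<close>
  define r where "r z = max 0 (min (t z) 1)" for z
  define u where "u z = Complex (r z) (sqrt (1 - (r z)\<^sup>2))" for z
  have r: "0 \<le> r z" "r z \<le> 1" "(r z)\<^sup>2 \<le> 1" for z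
    by (auto simp: r_def power_le_one)
  have u1: "cmod (u z) = 1" for z
    using r(3)[of z] by (simp add: u_def cmod_def)
  have [measurable]: "r \<in> borel_measurable circle_measure"
    unfolding r_def by measurable
  have [measurable]: "u \<in> borel_measurable circle_measure"
    unfolding u_def Complex_eq by measurable
  have [measurable]: "(\<lambda>z. cnj (u z)) \<in> borel_measurable circle_measure"
    by (rule measurable_compose[OF _ borel_measurable_continuous_onI[OF continuous_on_cnj[OF continuous_on_id]]])
       measurable
  have u: "u \<in> Linf" "(\<lambda>z. cnj (u z)) \<in> Linf"
    by (auto intro!: LinfI[where C = 1] simp: u1)
  have \<alpha>u: "\<alpha> u = 1" "\<alpha> (\<lambda>z. cnj (u z)) = 1"
    using gauge_normD(6)[OF \<alpha> u(1)] gauge_normD(6)[OF \<alpha> u(2)] gauge_normD(5)[OF \<alpha>]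
    by (auto simp: u1)
  have tL: "(\<lambda>z. complex_of_real (t z)) \<in> Linf" 
    using t01 by (intro LinfI[where C = 1]) auto
  have rL: "(\<lambda>z. 1/2 * (u z + cnj (u z))) \<in> Linf"
    by (intro Linf_mult[OF Linf_const] Linf_add u)
  have "\<alpha> (\<lambda>z. complex_of_real (t z)) = \<alpha> (\<lambda>z. 1/2 * (u z + cnj (u z)))"
  proof (rule gauge_norm_AE_cong[OF \<alpha> tL rL])
    show "AE z in circle_measure. complex_of_real (t z) = 1/2 * (u z + cnj (u z))"
      using t01 by eventually_elim (simp add: complex_add_cnj u_def r_def)
  qed
  also have "\<dots> = 1/2 * \<alpha> (\<lambda>z. u z + cnj (u z))"
    using gauge_normD(3)[OF \<alpha> Linf_add[OF u], of "1/2"] by simp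
  also have "\<dots> \<le> 1"
    using gauge_normD(4)[OF \<alpha> u] \<alpha>u by simp
  finally show ?thesis .
qed

text \<open>By gauge invariance and homogeneity it is enough to treat |f| / C, which has values in
  [0, 1].\<close>

lemma gauge_norm_le:
  assumes \<alpha>: "normalized_gauge_norm \<alpha>" and f: "f \<in> Linf" and C: "0 < C"
    and le: "AE z in circle_measure. cmod (f z) \<le> C"
  shows "\<alpha> f \<le> C"
proof -
  have [measurable]: "f \<in> borel_measurable circle_measure" using f by (rule Linf_measurable)
  have le1: "AE z in circle_measure. cmod (f z) / C \<le> 1"
    using le by eventually_elim (use C in simp)
  have L: "(\<lambda>z. complex_of_real (cmod (f z) / C)) \<in> Linf"
    using le1 C by (intro LinfI[where C = 1]) (simp_all del: of_real_divide)
  have "\<alpha> f = \<alpha> (\<lambda>z. of_real C * complex_of_real (cmod (f z) / C))"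
    using gauge_normD(6)[OF \<alpha> f] C by simp
  also have "\<dots> = C * \<alpha> (\<lambda>z. complex_of_real (cmod (f z) / C))"
    using gauge_normD(3)[OF \<alpha> L, of "of_real C"] C by simp
  also have "\<dots> \<le> C * 1"
    using C le1 by (intro mult_left_mono gauge_norm_le_one[OF \<alpha>]) auto
  finally show ?thesis by simp
qed

lemma ext_norm_upper:
  assumes "simple_function circle_measure s" "AE z in circle_measure. 0 \<le> s z \<and> s z \<le> cmod (f z)"
  shows "ennreal (\<alpha> (\<lambda>z. complex_of_real (s z))) \<le> ext_norm \<alpha> f"
  unfolding ext_norm_def by (rule SUP_upper) (use assms in simp)

lemma Linf_subset_L_closure:
  assumes \<alpha>: "normalized_gauge_norm \<alpha>"
  shows "Linf \<subseteq> L_closure \<alpha>"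
proof
  fix f assume f: "f \<in> Linf"
  obtain C where C: "0 < C" "AE z in circle_measure. cmod (f z) \<le> C"
    using f by (rule LinfE)
  have "ext_norm \<alpha> f \<le> ennreal C"
    unfolding ext_norm_def
  proof (rule SUP_least)
    fix s assume "s \<in> {s. simple_function circle_measure s \<and> (AE z in circle_measure. 0 \<le> s z \<and> s z \<le> cmod (f z))}"
    then have s: "simple_function circle_measure s" "AE z in circle_measure. 0 \<le> s z \<and> s z \<le> cmod (f z)"
      by auto
    have "AE z in circle_measure. cmod (complex_of_real (s z)) \<le> C"
      using s(2) C(2) by eventually_elim simp
    then show "ennreal (\<alpha> (\<lambda>z. complex_of_real (s z))) \<le> ennreal C"
      by (intro ennreal_leI gauge_norm_le[OF \<alpha>] simple_function_Linf s C(1))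
  qed
  \<comment> \<open>A bounded f is its own approximant: the only simple minorants of |f - f| vanish
    almost everywhere.\<close>
  moreover have "ext_norm \<alpha> (\<lambda>z. f z - f z) \<le> 0"
    unfolding ext_norm_def
  proof (rule SUP_least)
    fix s assume "s \<in> {s. simple_function circle_measure s \<and> (AE z in circle_measure. 0 \<le> s z \<and> s z \<le> cmod (f z - f z))}"
    then have s: "simple_function circle_measure s" "AE z in circle_measure. 0 \<le> s z \<and> s z \<le> 0"
      by auto
    have "\<alpha> (\<lambda>z. complex_of_real (s z)) = 0"
      unfolding gauge_normD(2)[OF \<alpha> simple_function_Linf[OF s(1)]]
      using s(2) by eventually_elim simp
    then show "ennreal (\<alpha> (\<lambda>z. complex_of_real (s z))) \<le> 0" by simp
  qed
  ultimately show "f \<in> L_closure \<alpha>"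
    using f unfolding L_closure_def script_L_def
    by (auto simp: Linf_measurable less_top[symmetric] top_unique intro!: bexI[of _ f])
qed

section \<open>Integrability and Hoelder's inequality for the extended norms\<close>

lemma integrable_Fatou:
  fixes f :: "'a \<Rightarrow> 'b::{banach, second_countable_topology}" and s :: "nat \<Rightarrow> 'a \<Rightarrow> real"
  assumes f: "f \<in> borel_measurable M" and s: "\<And>i. integrable M (s i)" "\<And>i x. 0 \<le> s i x"
    and lim: "\<And>x. x \<in> space M \<Longrightarrow> (\<lambda>i. s i x) \<longlonglongrightarrow> norm (f x)"
    and le: "\<And>i. (\<integral>x. s i x \<partial>M) \<le> C"
  shows "integrable M f"
proof (rule integrableI_bounded[OF f])
  have [measurable]: "s i \<in> borel_measurable M" for i using s(1) by auto
  have "(\<integral>\<^sup>+x. ennreal (norm (f x)) \<partial>M) = (\<integral>\<^sup>+x. liminf (\<lambda>i. ennreal (s i x)) \<partial>M)"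
    by (intro nn_integral_cong lim_imp_Liminf[symmetric] tendsto_ennrealI lim) simp_all
  also have "\<dots> \<le> liminf (\<lambda>i. \<integral>\<^sup>+x. ennreal (s i x) \<partial>M)"
    by (rule nn_integral_liminf) simp
  also have "\<dots> \<le> ennreal C"
    using s le by (intro Liminf_le always_eventually allI) (simp_all add: nn_integral_eq_integral ennreal_leI)
  also have "\<dots> < \<infinity>" by simp
  finally show "(\<integral>\<^sup>+x. ennreal (norm (f x)) \<partial>M) < \<infinity>" .
qed

lemma simple_approx_cmod:
  assumes [measurable]: "f \<in> borel_measurable M"
  obtains s :: "nat \<Rightarrow> 'a \<Rightarrow> real" where "\<And>i. simple_function M (s i)" "\<And>i z. 0 \<le> s i z"
    "\<And>i z. s i z \<le> cmod (f z)" "\<And>z. (\<lambda>i. s i z) \<longlonglongrightarrow> cmod (f z)"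
proof -
  have "(\<lambda>z. cmod (f z)) \<in> borel_measurable M" by measurable
  from borel_measurable_implies_simple_function_sequence_real[OF this norm_ge_zero]
  obtain s where s: "incseq s" "\<And>i. simple_function M (s i)" "\<And>z. bdd_above (range (\<lambda>i. s i z))"
    "\<And>i z. 0 \<le> s i z" "(\<lambda>z. cmod (f z)) = (SUP i. s i)"
    by blast
  have eq: "cmod (f z) = (SUP i. s i z)" for z
    using fun_cong[OF s(5), of z] by (simp add: image_image)
  show thesis
  proof
    show "s i z \<le> cmod (f z)" for i z
      unfolding eq by (rule cSUP_upper[OF _ s(3)]) simp
    show "(\<lambda>i. s i z) \<longlonglongrightarrow> cmod (f z)" for z
      unfolding eq using s(1,3) by (intro LIMSEQ_incseq_SUP) (auto simp: incseq_def le_fun_def)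
  qed (use s in auto)
qed

lemma script_L_upper:
  assumes "f \<in> script_L \<alpha>" "simple_function circle_measure s" "\<And>z. 0 \<le> s z" "\<And>z. s z \<le> cmod (f z)"
  shows "\<alpha> (\<lambda>z. complex_of_real (s z)) \<le> enn2real (ext_norm \<alpha> f)"
proof -
  have "ennreal (\<alpha> (\<lambda>z. complex_of_real (s z))) \<le> ext_norm \<alpha> f"
    using assms by (intro ext_norm_upper) auto
  also have "\<dots> = ennreal (enn2real (ext_norm \<alpha> f))"
    using assms(1) by (simp add: script_L_def)
  finally show ?thesis by (rule ennreal_le_iff[THEN iffD1, rotated]) simp
qed

text \<open>Domination is required on nonnegative simple functions only, so that the lemma serves
  both \<alpha> and its dual norm. Simple functions below |f| then have bounded integrals, and
  Fatou's lemma applies.\<close>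

lemma script_L_subset_L1:
  assumes c: "0 < c" and le: "\<And>s. simple_function circle_measure s \<Longrightarrow> (\<And>z. 0 \<le> s z) \<Longrightarrow>
      c * (\<integral>z. s z \<partial>circle_measure) \<le> \<alpha> (\<lambda>z. complex_of_real (s z))"
  shows "script_L \<alpha> \<subseteq> L1"
proof
  fix f assume f: "f \<in> script_L \<alpha>"
  then have m: "f \<in> borel_measurable circle_measure" by (simp add: script_L_def)
  obtain s :: "nat \<Rightarrow> complex \<Rightarrow> real" where s: "\<And>i. simple_function circle_measure (s i)"
    "\<And>i z. 0 \<le> s i z" "\<And>i z. s i z \<le> cmod (f z)" "\<And>z. (\<lambda>i. s i z) \<longlonglongrightarrow> cmod (f z)"
    using simple_approx_cmod[OF m] by blast
  have "integrable circle_measure f"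
  proof (rule integrable_Fatou[OF m])
    show "integrable circle_measure (s i)" for i
      using integrable_Re[OF Linf_integrable[OF simple_function_Linf[OF s(1)[of i]]]] by simp
    show "(\<integral>z. s i z \<partial>circle_measure) \<le> enn2real (ext_norm \<alpha> f) / c" for i
      using order_trans[OF le[OF s(1,2)] script_L_upper[OF f s(1-3)], of i] c by (simp add: field_simps)
  qed (use s in auto)
  then show "f \<in> L1" by (simp add: L1_def)
qed

lemma L_closure_subset_script_L: "L_closure \<alpha> \<subseteq> script_L \<alpha>"
  by (auto simp: L_closure_def)

lemma script_L_subset_L1_dominating:
  assumes "L1_dominating \<alpha>"
  shows "script_L \<alpha> \<subseteq> L1"
proof -
  obtain c where c: "0 < c" "\<And>f. f \<in> Linf \<Longrightarrow> c * (\<integral>x. cmod (f x) \<partial>circle_measure) \<le> \<alpha> f"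
    using assms by (auto simp: L1_dominating_def)
  show ?thesis
  proof (rule script_L_subset_L1[OF c(1)])
    fix s :: "complex \<Rightarrow> real" assume "simple_function circle_measure s" "\<And>z. 0 \<le> s z"
    then show "c * (\<integral>z. s z \<partial>circle_measure) \<le> \<alpha> (\<lambda>z. complex_of_real (s z))"
      using c(2)[OF simple_function_Linf[of s]] by simp
  qed
qed

text \<open>A real supremum bounds its members only if the set is bounded above. With |f| \<le> C
  and domination constant c, each integral is at most C times the \<open>L\<^sup>1\<close> norm of
  h, hence at most C / c.\<close>

lemma dual_norm_upper:
  assumes \<alpha>: "normalized_gauge_norm \<alpha>" and dom: "L1_dominating \<alpha>"
    and f: "f \<in> Linf" and h: "h \<in> Linf" "\<alpha> h \<le> 1"
  shows "cmod (\<integral>z. f z * h z \<partial>circle_measure) \<le> dual_norm \<alpha> f"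
  unfolding dual_norm_def
proof (rule cSUP_upper)
  obtain C where C: "0 < C" "AE z in circle_measure. cmod (f z) \<le> C"
    using f by (rule LinfE)
  obtain c where c: "0 < c" "\<And>f. f \<in> Linf \<Longrightarrow> c * (\<integral>x. cmod (f x) \<partial>circle_measure) \<le> \<alpha> f"
    using dom by (auto simp: L1_dominating_def)
  show "bdd_above ((\<lambda>h. cmod (\<integral>z. f z * h z \<partial>circle_measure)) ` {h \<in> Linf. \<alpha> h \<le> 1})"
  proof (rule bdd_aboveI2)
    fix h assume h: "h \<in> {h \<in> Linf. \<alpha> h \<le> 1}"
    have "cmod (\<integral>z. f z * h z \<partial>circle_measure) \<le> (\<integral>z. cmod (f z * h z) \<partial>circle_measure)"
      by (rule integral_norm_bound)
    also have "\<dots> \<le> (\<integral>z. C * cmod (h z) \<partial>circle_measure)"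
    proof (rule integral_mono_AE)
      show "AE z in circle_measure. cmod (f z * h z) \<le> C * cmod (h z)"
        using C(2) by eventually_elim (simp add: norm_mult mult_right_mono)
    qed (use f h in \<open>auto intro!: integrable_norm Linf_integrable Linf_mult integrable_mult_right\<close>)
    also have "\<dots> \<le> C * (1 / c)"
      using C(1) c(1) c(2)[of h] h by (simp add: field_simps)
    finally show "cmod (\<integral>z. f z * h z \<partial>circle_measure) \<le> C * (1 / c)" .
  qed
qed (use h in auto)

text \<open>Testing against h = 1, which is admissible as \<alpha>(1) = 1, bounds the integral of a
  nonnegative simple function by its dual norm.\<close>

lemma script_L_dual_subset_L1:
  assumes \<alpha>: "normalized_gauge_norm \<alpha>" and dom: "L1_dominating \<alpha>"
  shows "script_L (dual_norm \<alpha>) \<subseteq> L1"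
proof (rule script_L_subset_L1[of 1])
  fix s :: "complex \<Rightarrow> real" assume s: "simple_function circle_measure s" "\<And>z. 0 \<le> s z"
  have "(\<integral>z. s z \<partial>circle_measure) \<le> cmod (\<integral>z. complex_of_real (s z) * 1 \<partial>circle_measure)"
    by (simp add: integral_nonneg_AE s(2))
  also have "\<dots> \<le> dual_norm \<alpha> (\<lambda>z. complex_of_real (s z))"
    using gauge_normD(5)[OF \<alpha>] by (intro dual_norm_upper[OF \<alpha> dom] simple_function_Linf s Linf_const) simp
  finally show "1 * (\<integral>z. s z \<partial>circle_measure) \<le> dual_norm \<alpha> (\<lambda>z. complex_of_real (s z))" by simp
qed simp

text \<open>Normalize h by \<alpha>(h); if \<alpha>(h) = 0, then h vanishes almost everywhere and so
  does the integral.\<close>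

lemma dual_norm_Hoelder:
  assumes \<alpha>: "normalized_gauge_norm \<alpha>" and dom: "L1_dominating \<alpha>"
    and f: "f \<in> Linf" and h: "h \<in> Linf"
  shows "cmod (\<integral>z. f z * h z \<partial>circle_measure) \<le> dual_norm \<alpha> f * \<alpha> h"
proof (cases "\<alpha> h = 0")
  case True
  then have "AE z in circle_measure. h z = 0"
    using gauge_normD(2)[OF \<alpha> h] by simp
  then have "(\<integral>z. f z * h z \<partial>circle_measure) = 0"
    by (intro integral_eq_zero_AE) (auto elim: eventually_mono)
  then show ?thesis using True by simp
next
  case False
  then have pos: "0 < \<alpha> h" using gauge_normD(1)[OF \<alpha> h] by simp
  define g where "g z = of_real (1 / \<alpha> h) * h z" for z
  have "g \<in> Linf" unfolding g_def by (intro Linf_mult Linf_const h)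
  moreover have "\<alpha> g \<le> 1"
    unfolding g_def gauge_normD(3)[OF \<alpha> h] using pos by (simp add: norm_divide)
  ultimately have "cmod (\<integral>z. f z * g z \<partial>circle_measure) \<le> dual_norm \<alpha> f"
    by (intro dual_norm_upper assms)
  moreover have "(\<integral>z. f z * g z \<partial>circle_measure) = of_real (1 / \<alpha> h) * (\<integral>z. f z * h z \<partial>circle_measure)"
    unfolding g_def by (subst integral_mult_right_zero[symmetric]) (simp add: mult_ac)
  ultimately show ?thesis
    using pos by (simp add: norm_mult norm_divide field_simps)
qed

text \<open>Hoelder's inequality for simple functions below |f| and |g| bounds the integrals of
  their products by the product of the extended norms. Fatou's lemma passes to |f g|.\<close>

lemma script_L_mult_dual_integrable:
  assumes \<alpha>: "normalized_gauge_norm \<alpha>" and dom: "L1_dominating \<alpha>"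
    and f: "f \<in> script_L \<alpha>" and g: "g \<in> script_L (dual_norm \<alpha>)"
  shows "integrable circle_measure (\<lambda>z. f z * g z)"
proof -
  have m: "f \<in> borel_measurable circle_measure" "g \<in> borel_measurable circle_measure"
    using f g by (auto simp: script_L_def)
  obtain s :: "nat \<Rightarrow> complex \<Rightarrow> real" where s: "\<And>i. simple_function circle_measure (s i)"
    "\<And>i z. 0 \<le> s i z" "\<And>i z. s i z \<le> cmod (f z)" "\<And>z. (\<lambda>i. s i z) \<longlonglongrightarrow> cmod (f z)"
    using simple_approx_cmod[OF m(1)] by blast
  obtain t :: "nat \<Rightarrow> complex \<Rightarrow> real" where t: "\<And>i. simple_function circle_measure (t i)"
    "\<And>i z. 0 \<le> t i z" "\<And>i z. t i z \<le> cmod (g z)" "\<And>z. (\<lambda>i. t i z) \<longlonglongrightarrow> cmod (g z)"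
    using simple_approx_cmod[OF m(2)] by blast
  show ?thesis
  proof (rule integrable_Fatou[where s = "\<lambda>i z. t i z * s i z" and
        C = "enn2real (ext_norm (dual_norm \<alpha>) g) * enn2real (ext_norm \<alpha> f)"])
    show "integrable circle_measure (\<lambda>z. t i z * s i z)" for i
      using integrable_Re[OF Linf_integrable[OF simple_function_Linf[OF simple_function_mult[OF t(1)[of i] s(1)[of i]]]]]
      by simp
    show "(\<lambda>i. t i z * s i z) \<longlonglongrightarrow> norm (f z * g z)" for z
      unfolding norm_mult mult.commute[of "norm (f z)"] by (intro tendsto_mult s t)
    show "(\<integral>z. t i z * s i z \<partial>circle_measure) \<le>
        enn2real (ext_norm (dual_norm \<alpha>) g) * enn2real (ext_norm \<alpha> f)" for i
    proof -
      have "(\<integral>z. t i z * s i z \<partial>circle_measure) =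
          Re (\<integral>z. complex_of_real (t i z * s i z) \<partial>circle_measure)"
        by (simp del: of_real_mult)
      also have "\<dots> \<le> cmod (\<integral>z. complex_of_real (t i z) * complex_of_real (s i z) \<partial>circle_measure)"
        using complex_Re_le_cmod by simp
      also have "\<dots> \<le> dual_norm \<alpha> (\<lambda>z. complex_of_real (t i z)) * \<alpha> (\<lambda>z. complex_of_real (s i z))"
        by (intro dual_norm_Hoelder[OF \<alpha> dom] simple_function_Linf s t)
      also have "\<dots> \<le> enn2real (ext_norm (dual_norm \<alpha>) g) * enn2real (ext_norm \<alpha> f)"
        by (intro mult_mono script_L_upper[OF f s(1-3)] script_L_upper[OF g t(1-3)]
            gauge_normD(1)[OF \<alpha>] simple_function_Linf s) simp
      finally show ?thesis .
    qed
  qed (use m s t in auto)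
qed

section \<open>Pairing topologies\<close>

text \<open>Any g with U = UNIV contributes all of X as a generator. For empty Y there would be no
  generators and the \<open>topspace\<close> would be empty.\<close>

lemma topspace_pairing_topology:
  assumes "Y \<noteq> {}"
  shows "topspace (pairing_topology X Y) = X"
proof
  obtain g where "g \<in> Y" using assms by blast
  then have "X \<in> {{f \<in> X. (\<integral>x. f x * g x \<partial>circle_measure) \<in> U} | g U. g \<in> Y \<and> open U}"
    by (force intro!: exI[of _ g] exI[of _ UNIV])
  then show "X \<subseteq> topspace (pairing_topology X Y)"
    unfolding pairing_topology_def topology_generated_by_topspace by blast
qed (auto simp: pairing_topology_def)

text \<open>Induction on how W is generated: eventual membership is preserved by finite
  intersections and arbitrary unions, and for a generator it is convergence of one pairing.\<close>

lemma eventually_in_pairing_open: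
  assumes "openin (pairing_topology X Y) W" "f \<in> W" "\<And>n. s n \<in> X"
    and "\<And>g. g \<in> Y \<Longrightarrow>
      (\<lambda>n. \<integral>x. s n x * g x \<partial>circle_measure) \<longlonglongrightarrow> (\<integral>x. f x * g x \<partial>circle_measure)"
  shows "\<forall>\<^sub>F n in sequentially. s n \<in> W"
  using assms(1)[unfolded pairing_topology_def, THEN openin_topology_generated_by] assms(2)
proof induction
  case (Int a b)
  then show ?case by (auto intro: eventually_conj)
next
  case (UN K)
  then obtain k where "k \<in> K" "\<forall>\<^sub>F n in sequentially. s n \<in> k" by blast
  then show ?case by (auto elim: eventually_mono)
next
  case (Basis W)
  then obtain g U where gU: "g \<in> Y" "open U" "W = {f \<in> X. (\<integral>x. f x * g x \<partial>circle_measure) \<in> U}"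
    by blast
  have "\<forall>\<^sub>F n in sequentially. (\<integral>x. s n x * g x \<partial>circle_measure) \<in> U"
    using assms(4)[OF gU(1)] gU(2,3) Basis(2) by (intro topological_tendstoD) auto
  then show ?case
    using assms(3) gU(3) by (auto elim: eventually_mono)
qed simp

text \<open>The topology need not be first countable, but closed sets contain limits of sequences in
  any topology, and only this direction is needed.\<close>

lemma pairing_closed_sequentially:
  assumes "closedin (pairing_topology X Y) C" "Y \<noteq> {}" "\<And>n. s n \<in> C" "f \<in> X"
    and "\<And>g. g \<in> Y \<Longrightarrow>
      (\<lambda>n. \<integral>x. s n x * g x \<partial>circle_measure) \<longlonglongrightarrow> (\<integral>x. f x * g x \<partial>circle_measure)"
  shows "f \<in> C"
proof (rule ccontr)
  assume "f \<notin> C"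
  have C: "C \<subseteq> X" "openin (pairing_topology X Y) (X - C)"
    using assms(1,2) by (auto simp: closedin_def topspace_pairing_topology)
  have "\<forall>\<^sub>F n in sequentially. s n \<in> X - C"
    by (rule eventually_in_pairing_open[OF C(2) _ _ assms(5)])
       (use \<open>f \<notin> C\<close> assms(3,4) C(1) in auto)
  then show False
    using assms(3) by simp
qed

text \<open>The preimage of a generator of the coarser topology is the generator given by the same g
  and U.\<close>

lemma pairing_topology_id_continuous:
  assumes "X \<subseteq> X'" "Y' \<subseteq> Y" "Y' \<noteq> {}"
  shows "continuous_map (pairing_topology X Y) (pairing_topology X' Y') (\<lambda>f. f)"
proof -
  have top: "topspace (pairing_topology X Y) = X" "topspace (pairing_topology X' Y') = X'"
    using assms by (auto intro!: topspace_pairing_topology)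
  show ?thesis
    unfolding pairing_topology_def[of X' Y']
  proof (rule continuous_on_generated_topo)
    fix W assume "W \<in> {{f \<in> X'. (\<integral>x. f x * g x \<partial>circle_measure) \<in> U} | g U. g \<in> Y' \<and> open U}"
    then obtain g U where gU: "g \<in> Y'" "open U" "W = {f \<in> X'. (\<integral>x. f x * g x \<partial>circle_measure) \<in> U}"
      by blast
    have "openin (pairing_topology X Y) {f \<in> X. (\<integral>x. f x * g x \<partial>circle_measure) \<in> U}"
      unfolding pairing_topology_def
      by (rule topology_generated_by_Basis) (use gU assms in blast)
    moreover have "(\<lambda>f. f) -` W \<inter> X = {f \<in> X. (\<integral>x. f x * g x \<partial>circle_measure) \<in> U}"
      using gU(3) assms(1) by auto
    ultimately show "openin (pairing_topology X Y) ((\<lambda>f. f) -` W \<inter> topspace (pairing_topology X Y))"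
      using top by simp
  next
    show "(\<lambda>f. f) ` topspace (pairing_topology X Y) \<subseteq>
        \<Union> {{f \<in> X'. (\<integral>x. f x * g x \<partial>circle_measure) \<in> U} | g U. g \<in> Y' \<and> open U}"
      using top assms(1) unfolding pairing_topology_def topology_generated_by_topspace by simp
  qed
qed

section \<open>Shift-invariant subspaces and the two limit passages\<close>

lemma linear_subspace_poly_mult:
  assumes M: "linear_subspace M" and z: "\<forall>f\<in>M. (\<lambda>z. z * f z) \<in> M" and f: "f \<in> M"
  shows "(\<lambda>z. poly p z * f z) \<in> M"
proof (induction p)
  case 0
  then show ?case using M by (simp add: linear_subspace_def)
next
  case (pCons a p)
  have "(\<lambda>z. a * f z) \<in> M" "(\<lambda>z. z * (poly p z * f z)) \<in> M"
    using M f z pCons.IH by (auto simp: linear_subspace_def)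
  then have "(\<lambda>z. a * f z + z * (poly p z * f z)) \<in> M"
    using M unfolding linear_subspace_def by fast
  then show ?case by (simp add: algebra_simps)
qed

text \<open>Dominated convergence with majorant B |f|. In the application the product f g takes the
  place of f, so one statement covers both limits of the main argument.\<close>

lemma tendsto_integral_mult_bounded:
  fixes s :: "nat \<Rightarrow> complex \<Rightarrow> complex"
  assumes "integrable circle_measure f" and [measurable]: "\<And>n. s n \<in> borel_measurable circle_measure"
    "k \<in> borel_measurable circle_measure"
    and "\<And>n. AE z in circle_measure. cmod (s n z) \<le> B"
    and "AE z in circle_measure. (\<lambda>n. s n z) \<longlonglongrightarrow> k z"
  shows "(\<lambda>n. \<integral>z. s n z * f z \<partial>circle_measure) \<longlonglongrightarrow> (\<integral>z. k z * f z \<partial>circle_measure)"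
proof (rule integral_dominated_convergence[where w = "\<lambda>z. B * cmod (f z)"])
  have [measurable]: "f \<in> borel_measurable circle_measure" using assms(1) by auto
  show "(\<lambda>z. s n z * f z) \<in> borel_measurable circle_measure"
    "(\<lambda>z. k z * f z) \<in> borel_measurable circle_measure" for n
    by measurable
  show "integrable circle_measure (\<lambda>z. B * cmod (f z))" using assms(1) by simp
  show "AE z in circle_measure. (\<lambda>n. s n z * f z) \<longlonglongrightarrow> k z * f z"
    using assms(5) by eventually_elim (intro tendsto_intros)
  show "AE z in circle_measure. norm (s n z * f z) \<le> B * cmod (f z)" for n
    using assms(4)[of n] by eventually_elim (simp add: norm_mult mult_right_mono)
qed

theorem theorem3p8:
  fixes \<alpha> :: "(complex \<Rightarrow> complex) \<Rightarrow> real"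
    and M :: "(complex \<Rightarrow> complex) set"
  assumes "normalized_gauge_norm \<alpha>"
    and "L1_dominating \<alpha>"
    and "M \<subseteq> L_closure \<alpha>"
    and "linear_subspace M"
    and "closedin (sigma_topology \<alpha>) M"
    and "\<forall>f\<in>M. (\<lambda>z. z * f z) \<in> M"
  shows "closedin weak_star_topology (M \<inter> Linf)
       \<and> M = sigma_topology \<alpha> closure_of (M \<inter> Linf)"
proof
  let ?X = "L_closure \<alpha>" and ?Y = "L_closure (dual_norm \<alpha>)"
  note \<alpha> = assms(1) and dom = assms(2)
  have "M \<noteq> {}" using assms(4) by (auto simp: linear_subspace_def)
  \<comment> \<open>An empty \<open>?Y\<close> would make the \<open>topspace\<close> empty, yet it
    contains the nonempty set M.\<close>
  then have Y: "?Y \<noteq> {}"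
    using closedin_subset[OF assms(5)] by (auto simp: sigma_topology_def pairing_topology_def)
  have Linf: "Linf \<subseteq> ?X" by (rule Linf_subset_L_closure[OF \<alpha>])
  have YL1: "?Y \<subseteq> L1"
    using L_closure_subset_script_L script_L_dual_subset_L1[OF \<alpha> dom] by (rule order_trans)
  \<comment> \<open>Along this inclusion the preimage of the closed set M is its bounded
    part.\<close>
  have "continuous_map weak_star_topology (sigma_topology \<alpha>) (\<lambda>f. f)"
    unfolding weak_star_topology_def sigma_topology_def
    by (rule pairing_topology_id_continuous[OF Linf YL1 Y])
  then have "closedin weak_star_topology {f \<in> topspace weak_star_topology. f \<in> M}"
    using assms(5) by (rule closedin_continuous_map_preimage)
  moreover have "topspace weak_star_topology = Linf"
    using Y YL1 unfolding weak_star_topology_def by (intro topspace_pairing_topology) blast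
  ultimately show "closedin weak_star_topology (M \<inter> Linf)"
    by (simp add: Collect_conj_eq Int_commute)
  show "M = sigma_topology \<alpha> closure_of (M \<inter> Linf)"
  proof
    show "sigma_topology \<alpha> closure_of (M \<inter> Linf) \<subseteq> M"
      by (rule closure_of_minimal[OF _ assms(5)]) simp
    show "M \<subseteq> sigma_topology \<alpha> closure_of (M \<inter> Linf)"
    proof
      fix f assume f: "f \<in> M"
      then have fL: "f \<in> ?X" "f \<in> script_L \<alpha>"
        using assms(3) L_closure_subset_script_L by auto
      then have "integrable circle_measure f"
        using script_L_subset_L1_dominating[OF dom] by (auto simp: L1_def)
      then obtain k :: "nat \<Rightarrow> complex \<Rightarrow> complex" and q :: "nat \<Rightarrow> nat \<Rightarrow> complex poly" where
        k: "\<And>n. k n \<in> borel_measurable circle_measure"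
          "\<And>n. AE z in circle_measure. cmod (k n z) \<le> 1"
          "\<And>n. AE z in circle_measure. cmod (k n z * f z) \<le> 2 * (real (Suc n))\<^sup>2"
          "AE z in circle_measure. (\<lambda>n. k n z) \<longlonglongrightarrow> 1" and
        q: "\<And>n j z. z \<in> sphere 0 1 \<Longrightarrow> cmod (poly (q n j) z) \<le> 4"
          "\<And>n. AE z in circle_measure. (\<lambda>j. poly (q n j) z) \<longlonglongrightarrow> k n z"
        using bounded_analytic_multipliers by blast
      have fg: "integrable circle_measure (\<lambda>z. f z * g z)" if "g \<in> ?Y" for g
        using that fL(2) L_closure_subset_script_L by (intro script_L_mult_dual_integrable[OF \<alpha> dom]) auto
      have kLinf: "(\<lambda>z. k n z * f z) \<in> Linf" for n
        by (rule LinfI[OF borel_measurable_times[OF k(1)] k(3)])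
           (use fL(2) in \<open>simp add: script_L_def\<close>)
      \<comment> \<open>First limit, in j with n fixed: polynomial multiples of f stay in M, and 4
        |f g| dominates the pairings with g.\<close>
      have "(\<lambda>z. k n z * f z) \<in> M" for n
      proof (rule pairing_closed_sequentially[OF assms(5)[unfolded sigma_topology_def] Y])
        show "(\<lambda>z. poly (q n j) z * f z) \<in> M" for j
          by (rule linear_subspace_poly_mult[OF assms(4,6) f])
        show "(\<lambda>z. k n z * f z) \<in> ?X" using kLinf Linf by auto
        show "(\<lambda>j. \<integral>z. poly (q n j) z * f z * g z \<partial>circle_measure) \<longlonglongrightarrow>
            (\<integral>z. k n z * f z * g z \<partial>circle_measure)" if "g \<in> ?Y" for g
          unfolding mult.assoc
          by (rule tendsto_integral_mult_bounded[OF fg[OF that] _ k(1) _ q(2), where B = 4])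
             (use q(1) in \<open>auto intro!: AE_I2\<close>)
      qed
      then have kM: "(\<lambda>z. k n z * f z) \<in> sigma_topology \<alpha> closure_of (M \<inter> Linf)" for n
        using kLinf closure_of_subset[of "M \<inter> Linf" "sigma_topology \<alpha>"] closedin_subset[OF assms(5)]
        by blast
      \<comment> \<open>Second limit, in n: the bounded functions \<open>k n\<close> f already lie
        in M, and |f g| dominates their pairings with g.\<close>
      show "f \<in> sigma_topology \<alpha> closure_of (M \<inter> Linf)"
        unfolding sigma_topology_def
      proof (rule pairing_closed_sequentially[OF closedin_closure_of Y _ fL(1)])
        show "(\<lambda>z. k n z * f z) \<in> pairing_topology ?X ?Y closure_of (M \<inter> Linf)" for n
          using kM unfolding sigma_topology_def .
        show "(\<lambda>n. \<integral>z. k n z * f z * g z \<partial>circle_measure) \<longlonglongrightarrow>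
            (\<integral>z. f z * g z \<partial>circle_measure)" if "g \<in> ?Y" for g
          using tendsto_integral_mult_bounded[OF fg[OF that] k(1) _ k(2,4)]
          by (simp add: mult.assoc)
      qed
    qed
  qed
qed

end
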